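(* Let $R$ be a commutative Noetherian ring. (1) If $\mathfrak{m}$ is a maximal ideal of $R$ generated by $n$ elements, then the $R$-module $R/\mathfrak{m}$ admits a quasi-projective resolution of length $n$. In particular, for every (commutative Noetherian) local ring $R$ with residue field $k$ one has $\operatorname{qpd}_Rk\le\operatorname{edim} R<\infty$. (2) If $M\ne0$ is a periodic $R$-module of periodicity $r$, then $\operatorname{qpd}_RM=0$.
   Context: For a complex $X$ of $R$-modules put $\sup X=\sup\{i: X_i\neq 0\}$, $\inf X=\inf\{i: X_i\neq0\}$, $\operatorname{hsup}X=\sup\{i: H_i(X)\neq0\}$; the length of $X$ is $\sup X-\inf X$. A quasi-projective resolution of an $R$-module $M$ is a bounded below complex $P$ of projective $R$-modules such that for all $i\ge\inf P$ there are integers $a_i\ge0$, not all zero, with $H_i(P)\cong M^{\oplus a_i}$; it is finite if $P$ is bounded. For $M\neq0$, $\operatorname{qpd}_RM=\inf\{\sup P-\operatorname{hsup}P : P \text{ a finite quasi-projective resolution of } M\}$ (which is $\infty$ if no such $P$ exists). $\operatorname{edim}R$ is the embedding dimension of the local ring $R$. An $R$-module $M$ is periodic if there exist an integer $r>0$ and a projective resolution $(P,\partial)=(\cdots\xrightarrow{\partial_2}P_1\xrightarrow{\partial_1}P_0\to0)$ of $M$ such that $P_{i}=P_{r+i}$ for all $i\ge0$ and $\partial_i=\partial_{r+i}$ for all $i\ge1$. The minimal such $r$ is the periodicity of $M$. *)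

theory Defs
  imports
    "HOL-Algebra.QuotRing"
    "HOL-Algebra.Ideal_Product"
    "HOL-Algebra.Ring_Divisibility"
    "HOL-Library.Extended_Real"
    "Jordan_Normal_Form.Missing_VectorSpace"
begin

hide_const (open) Modules.module Modules.module_hom Multiset.mult

section \<open>Modules over a commutative ring\<close>

text \<open>
  The records of type \<^typ>\<open>('r, 'p) module\<close> extend rings, so every construction has to fill the
  fields \<^const>\<open>mult\<close> and \<^const>\<open>one\<close>; they play no role for modules and are set to zero.
\<close>

definition zero_module :: "('r, 'p, 'y) module_scheme \<Rightarrow> bool"
  where "zero_module M \<longleftrightarrow> carrier M = {\<zero>\<^bsub>M\<^esub>}"

definition module_iso ::
    "('r, 'x) ring_scheme \<Rightarrow> ('r, 'p, 'y) module_scheme \<Rightarrow> ('r, 'q, 'z) module_scheme \<Rightarrow> bool"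
  where "module_iso R M N \<longleftrightarrow>
    (\<exists>f \<in> module_hom R M N. bij_betw f (carrier M) (carrier N))"

definition ring_as_module :: "('r, 'x) ring_scheme \<Rightarrow> ('r, 'r) module"
  where "ring_as_module R =
    \<lparr>carrier = carrier R, mult = (\<lambda>_ _. \<zero>\<^bsub>R\<^esub>), one = \<zero>\<^bsub>R\<^esub>, zero = \<zero>\<^bsub>R\<^esub>,
     add = add R, smult = mult R\<rparr>"

text \<open>
  In the scalar multiplication of \<open>M/N\<close> all cosets in the union coincide when \<open>X\<close> is a coset of the
  submodule \<open>N\<close>, as in the library's \<^const>\<open>rcoset_mult\<close>.
\<close>

definition quot_module :: "('r, 'p, 'y) module_scheme \<Rightarrow> 'p set \<Rightarrow> ('r, 'p set) module"
  where "quot_module M N =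
    \<lparr>carrier = a_rcosets\<^bsub>M\<^esub> N, mult = (\<lambda>_ _. N), one = N, zero = N,
     add = set_add M, smult = (\<lambda>r X. \<Union>x\<in>X. N +>\<^bsub>M\<^esub> (r \<odot>\<^bsub>M\<^esub> x))\<rparr>"

text \<open>The direct sum of \<open>a\<close> copies of \<open>M\<close>, as the module of functions \<open>{..<a} \<rightarrow> M\<close>.\<close>

definition power_module :: "('r, 'p, 'y) module_scheme \<Rightarrow> nat \<Rightarrow> ('r, nat \<Rightarrow> 'p) module"
  where "power_module M a =
    \<lparr>carrier = {..<a} \<rightarrow>\<^sub>E carrier M,
     mult = (\<lambda>_ _. \<lambda>j\<in>{..<a}. \<zero>\<^bsub>M\<^esub>), one = (\<lambda>j\<in>{..<a}. \<zero>\<^bsub>M\<^esub>),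
     zero = (\<lambda>j\<in>{..<a}. \<zero>\<^bsub>M\<^esub>),
     add = (\<lambda>u v. \<lambda>j\<in>{..<a}. u j \<oplus>\<^bsub>M\<^esub> v j),
     smult = (\<lambda>r u. \<lambda>j\<in>{..<a}. r \<odot>\<^bsub>M\<^esub> u j)\<rparr>"

text \<open>The free module on a set \<open>S\<close>: finitely supported functions \<open>S \<rightarrow> R\<close>.\<close>

definition free_module :: "('r, 'x) ring_scheme \<Rightarrow> 's set \<Rightarrow> ('r, 's \<Rightarrow> 'r) module"
  where "free_module R S =
    (ring.func_space R S)\<lparr>carrier :=
      {u \<in> S \<rightarrow>\<^sub>E carrier R. finite {s \<in> S. u s \<noteq> \<zero>\<^bsub>R\<^esub>}}\<rparr>"

text \<open>
  A module is projective if it is a direct summand (that is, a retract) of a free module. Since a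
  free module mapping onto \<open>P\<close> can be chosen with basis the carrier of \<open>P\<close>, it is no restriction
  that the basis lives in the type of the elements of \<open>P\<close>. That this is the usual lifting property
  with respect to modules on arbitrary types is proved below (\<open>projective_lifting\<close>,
  \<open>lifting_projective\<close>).
\<close>

definition projective_module :: "('r, 'x) ring_scheme \<Rightarrow> ('r, 'p, 'y) module_scheme \<Rightarrow> bool"
  where "projective_module R P \<longleftrightarrow> module R P \<and>
    (\<exists>(S :: 'p set) i p. i \<in> module_hom R P (free_module R S) \<and>
       p \<in> module_hom R (free_module R S) P \<and> (\<forall>x\<in>carrier P. p (i x) = x))"

lemma free_module_simps:
  assumes "cring R"
  shows "carrier (free_module R S) = {u \<in> S \<rightarrow>\<^sub>E carrier R. finite {s \<in> S. u s \<noteq> \<zero>\<^bsub>R\<^esub>}}"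
    and "zero (free_module R S) = (\<lambda>s\<in>S. \<zero>\<^bsub>R\<^esub>)"
    and "add (free_module R S) = (\<lambda>u v. \<lambda>s\<in>S. u s \<oplus>\<^bsub>R\<^esub> v s)"
    and "smult (free_module R S) = (\<lambda>r u. \<lambda>s\<in>S. r \<otimes>\<^bsub>R\<^esub> u s)"
  using assms by (simp_all add: free_module_def ring.func_space_def cring.axioms(1))

lemma free_module_module:
  assumes "cring R"
  shows "module R (free_module R S)"
proof -
  interpret cring R by fact
  interpret F: module R "func_space S" by (rule func_space_is_module)
  have "LinearCombinations.submodule R
     {u \<in> S \<rightarrow>\<^sub>E carrier R. finite {s \<in> S. u s \<noteq> \<zero>\<^bsub>R\<^esub>}} (func_space S)"
  proof (unfold_locales, goal_cases)
    case (2 u v)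
    then have "finite ({s \<in> S. u s \<noteq> \<zero>\<^bsub>R\<^esub>} \<union> {s \<in> S. v s \<noteq> \<zero>\<^bsub>R\<^esub>})" by simp
    then have "finite {s \<in> S. u s \<oplus>\<^bsub>R\<^esub> v s \<noteq> \<zero>\<^bsub>R\<^esub>}"
      by (rule rev_finite_subset) auto
    with 2 show ?case by (auto simp: func_space_def PiE_mem2 cong: conj_cong)
  next
    case (4 c u)
    then have "finite {s \<in> S. c \<otimes>\<^bsub>R\<^esub> u s \<noteq> \<zero>\<^bsub>R\<^esub>}"
      by (auto elim: rev_finite_subset)
    with 4 show ?case by (auto simp: func_space_def PiE_mem2 cong: conj_cong)
  qed (auto simp: func_space_def cong: conj_cong)
  then show ?thesis
    unfolding free_module_def by (rule F.submodule_is_module)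
qed

definition free_basis :: "('r, 'x) ring_scheme \<Rightarrow> 's set \<Rightarrow> 's \<Rightarrow> 's \<Rightarrow> 'r"
  where "free_basis R S s = (\<lambda>t\<in>S. if t = s then \<one>\<^bsub>R\<^esub> else \<zero>\<^bsub>R\<^esub>)"

lemma free_basis_closed:
  assumes "cring R" and "s \<in> S"
  shows "free_basis R S s \<in> carrier (free_module R S)"
proof -
  interpret cring R by fact
  have "finite {t \<in> S. free_basis R S s t \<noteq> \<zero>\<^bsub>R\<^esub>}"
    by (rule finite_subset[of _ "{s}"]) (auto simp: free_basis_def)
  then show ?thesis by (auto simp: free_module_simps assms free_basis_def)
qed

lemma free_module_hom_eqI:
  assumes R: "cring R" and B: "module R B"
    and h: "h \<in> module_hom R (free_module R S) B" and k: "k \<in> module_hom R (free_module R S) B"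
    and eq: "\<And>s. s \<in> S \<Longrightarrow> h (free_basis R S s) = k (free_basis R S s)"
    and u: "u \<in> carrier (free_module R S)"
  shows "h u = k u"
proof -
  let ?F = "free_module R S"
  interpret R: cring R by fact
  have F: "module R ?F" using R by (rule free_module_module)
  interpret H: mod_hom R ?F B h using F B h by (simp add: mod_hom_def mod_hom_axioms_def)
  interpret K: mod_hom R ?F B k using F B k by (simp add: mod_hom_def mod_hom_axioms_def)
  have "\<And>u. u \<in> carrier ?F \<Longrightarrow> {s \<in> S. u s \<noteq> \<zero>\<^bsub>R\<^esub>} = T \<Longrightarrow> h u = k u" if "finite T" for T
    using that
  proof (induction T)
    case empty
    then have "u = \<zero>\<^bsub>?F\<^esub>"
      by (auto simp: free_module_simps[OF R] fun_eq_iff PiE_iff extensional_def)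
    then show ?case by simp
  next
    case (insert t T)
    let ?v = "u(t := \<zero>\<^bsub>R\<^esub>)" and ?w = "u t \<odot>\<^bsub>?F\<^esub> free_basis R S t"
    have t: "t \<in> S" "u t \<in> carrier R"
      using insert.prems by (auto simp: free_module_simps[OF R])
    have sub: "{s \<in> S. ?v s \<noteq> \<zero>\<^bsub>R\<^esub>} = T"
      using insert.prems(2) insert.hyps(2) by (auto split: if_splits)
    then have v: "?v \<in> carrier ?F"
      using insert.prems(1) insert.hyps(1) t by (auto simp: free_module_simps[OF R] PiE_iff extensional_def)
    have e: "free_basis R S t \<in> carrier ?F" using R t by (simp add: free_basis_closed)
    then have w: "?w \<in> carrier ?F" using t by simp
    have dec: "u = ?v \<oplus>\<^bsub>?F\<^esub> ?w"
      using insert.prems(1) t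
      by (auto simp: free_module_simps[OF R] free_basis_def fun_eq_iff PiE_iff extensional_def)
    have "h ?v = k ?v" using v sub by (rule insert.IH)
    moreover have "h ?w = k ?w" using e t eq by simp
    ultimately have "h (?v \<oplus>\<^bsub>?F\<^esub> ?w) = k (?v \<oplus>\<^bsub>?F\<^esub> ?w)" using v w by (simp del: fun_upd_apply)
    then show ?case using dec by simp
  qed
  moreover have "finite {s \<in> S. u s \<noteq> \<zero>\<^bsub>R\<^esub>}" using u by (simp add: free_module_simps[OF R])
  ultimately show ?thesis using u by blast
qed

lemma free_module_hom_exists:
  assumes A: "module R A" and a: "a \<in> S \<rightarrow> carrier A"
  obtains k where "k \<in> module_hom R (free_module R S) A"
    and "\<And>s. s \<in> S \<Longrightarrow> k (free_basis R S s) = a s"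
proof -
  interpret module R A by fact
  have R: "cring R" by unfold_locales
  let ?F = "free_module R S"
  note [simp] = free_module_simps[OF R]
  define supp where "supp u = {s \<in> S. u s \<noteq> \<zero>\<^bsub>R\<^esub>}" for u
  define k where "k u = (\<Oplus>\<^bsub>A\<^esub>s\<in>supp u. u s \<odot>\<^bsub>A\<^esub> a s)" for u
  have k: "k u = (\<Oplus>\<^bsub>A\<^esub>s\<in>T. u s \<odot>\<^bsub>A\<^esub> a s)"
    if "u \<in> S \<rightarrow> carrier R" "finite T" "supp u \<subseteq> T" "T \<subseteq> S" for u T
    unfolding k_def
    by (rule M.add.finprod_mono_neutral_cong_left) (use that a in \<open>auto simp: supp_def Pi_iff\<close>)
  have cl: "(\<lambda>s. u s \<odot>\<^bsub>A\<^esub> a s) \<in> T \<rightarrow> carrier A" if "u \<in> S \<rightarrow> carrier R" "T \<subseteq> S" for u T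
    using that a by (auto simp: Pi_iff)
  have hom: "k \<in> module_hom R ?F A"
    unfolding module_hom_def
  proof (intro CollectI conjI allI impI Pi_I)
    fix u assume "u \<in> carrier ?F"
    then show "k u \<in> carrier A"
      unfolding k_def by (intro M.finsum_closed cl) (auto simp: supp_def)
  next
    fix u v assume "u \<in> carrier ?F \<and> v \<in> carrier ?F"
    then have u: "u \<in> S \<rightarrow> carrier R" and v: "v \<in> S \<rightarrow> carrier R"
      and fin: "finite (supp u \<union> supp v)" by (auto simp: supp_def PiE_iff)
    let ?T = "supp u \<union> supp v"
    have T: "?T \<subseteq> S" by (auto simp: supp_def)
    have "k (u \<oplus>\<^bsub>?F\<^esub> v) = (\<Oplus>\<^bsub>A\<^esub>s\<in>?T. (u \<oplus>\<^bsub>?F\<^esub> v) s \<odot>\<^bsub>A\<^esub> a s)"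
      by (rule k) (use u v fin T in \<open>auto simp: supp_def Pi_iff\<close>)
    also have "\<dots> = (\<Oplus>\<^bsub>A\<^esub>s\<in>?T. u s \<odot>\<^bsub>A\<^esub> a s \<oplus>\<^bsub>A\<^esub> v s \<odot>\<^bsub>A\<^esub> a s)"
      by (rule M.finsum_cong')
        (use u v a T in \<open>auto simp: Pi_iff smult_l_distr subset_iff\<close>)
    also have "\<dots> = (\<Oplus>\<^bsub>A\<^esub>s\<in>?T. u s \<odot>\<^bsub>A\<^esub> a s) \<oplus>\<^bsub>A\<^esub> (\<Oplus>\<^bsub>A\<^esub>s\<in>?T. v s \<odot>\<^bsub>A\<^esub> a s)"
      by (intro M.finsum_addf cl u v T)
    also have "\<dots> = k u \<oplus>\<^bsub>A\<^esub> k v"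
      using k[OF u fin _ T] k[OF v fin _ T] by simp
    finally show "k (u \<oplus>\<^bsub>?F\<^esub> v) = k u \<oplus>\<^bsub>A\<^esub> k v" .
  next
    fix r u assume ru: "r \<in> carrier R \<and> u \<in> carrier ?F"
    then have r: "r \<in> carrier R" and u: "u \<in> S \<rightarrow> carrier R"
      and fin: "finite (supp u)" by (auto simp: supp_def PiE_iff)
    have T: "supp u \<subseteq> S" by (auto simp: supp_def)
    have "k (r \<odot>\<^bsub>?F\<^esub> u) = (\<Oplus>\<^bsub>A\<^esub>s\<in>supp u. (r \<odot>\<^bsub>?F\<^esub> u) s \<odot>\<^bsub>A\<^esub> a s)"
      by (rule k) (use r u fin T in \<open>auto simp: supp_def Pi_iff\<close>)
    also have "\<dots> = (\<Oplus>\<^bsub>A\<^esub>s\<in>supp u. r \<odot>\<^bsub>A\<^esub> (u s \<odot>\<^bsub>A\<^esub> a s))"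
      by (rule M.finsum_cong')
        (use r u a T in \<open>auto simp: Pi_iff smult_assoc1 subset_iff\<close>)
    also have "\<dots> = r \<odot>\<^bsub>A\<^esub> k u"
      unfolding k_def by (rule finsum_smult_ldistr[symmetric]) (use fin r cl[OF u T] in auto)
    finally show "k (r \<odot>\<^bsub>?F\<^esub> u) = r \<odot>\<^bsub>A\<^esub> k u" .
  qed
  have "k (free_basis R S s) = a s" if s: "s \<in> S" for s
  proof -
    have "k (free_basis R S s) = (\<Oplus>\<^bsub>A\<^esub>t\<in>{s}. free_basis R S s t \<odot>\<^bsub>A\<^esub> a t)"
      by (rule k) (use s in \<open>auto simp: supp_def free_basis_def\<close>)
    also have "\<dots> = a s" using s a by (subst M.finsum_insert) (auto simp: free_basis_def Pi_iff)
    finally show ?thesis .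
  qed
  with hom show thesis by (rule that)
qed

lemma module_hom_comp:
  "g \<in> module_hom R B C \<Longrightarrow> f \<in> module_hom R A B \<Longrightarrow> (\<lambda>x. g (f x)) \<in> module_hom R A C"
  by (auto simp: module_hom_def Pi_iff)

lemma projective_lifting:
  fixes P :: "('r, 'p, 'y) module_scheme"
  assumes P: "projective_module R P" and A: "module R A" and B: "module R B"
    and f: "f \<in> module_hom R A B" "f ` carrier A = carrier B" and g: "g \<in> module_hom R P B"
  obtains k where "k \<in> module_hom R P A" and "\<And>x. x \<in> carrier P \<Longrightarrow> f (k x) = g x"
proof -
  interpret module R A by fact
  have R: "cring R" by unfold_locales
  obtain S :: "'p set" and i p where ip: "i \<in> module_hom R P (free_module R S)"
      "p \<in> module_hom R (free_module R S) P" "\<And>x. x \<in> carrier P \<Longrightarrow> p (i x) = x"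
    using P unfolding projective_module_def by blast
  have gp: "(\<lambda>u. g (p u)) \<in> module_hom R (free_module R S) B"
    using g ip(2) by (rule module_hom_comp)
  have "\<exists>a\<in>carrier A. f a = g (p (free_basis R S s))" if "s \<in> S" for s
  proof -
    have "g (p (free_basis R S s)) \<in> carrier B"
      using gp free_basis_closed[OF R that] by (auto simp: module_hom_def)
    then show ?thesis using f(2) by (metis imageE)
  qed
  then obtain a where a: "\<And>s. s \<in> S \<Longrightarrow> a s \<in> carrier A"
      "\<And>s. s \<in> S \<Longrightarrow> f (a s) = g (p (free_basis R S s))" by metis
  obtain l where l: "l \<in> module_hom R (free_module R S) A"
      "\<And>s. s \<in> S \<Longrightarrow> l (free_basis R S s) = a s"
    by (rule free_module_hom_exists[OF A, of a S]) (use a in auto)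
  have fl: "f (l u) = g (p u)" if "u \<in> carrier (free_module R S)" for u
    by (rule free_module_hom_eqI[OF R B module_hom_comp[OF f(1) l(1)] gp _ that])
      (simp add: l a)
  show thesis
  proof (rule that)
    show "(\<lambda>x. l (i x)) \<in> module_hom R P A" using l(1) ip(1) by (rule module_hom_comp)
    show "f (l (i x)) = g x" if "x \<in> carrier P" for x
      using fl[of "i x"] ip(1,3) that by (auto simp: module_hom_def Pi_iff)
  qed
qed

lemma lifting_projective:
  fixes P :: "('r, 'p) module"
  assumes P: "module R P"
    and lift: "\<And>(A :: ('r, 'p \<Rightarrow> 'r) module) (B :: ('r, 'p) module) f g.
      \<lbrakk>module R A; module R B; f \<in> module_hom R A B; f ` carrier A = carrier B;
       g \<in> module_hom R P B\<rbrakk> \<Longrightarrow> \<exists>k \<in> module_hom R P A. \<forall>x\<in>carrier P. f (k x) = g x"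
  shows "projective_module R P"
proof -
  interpret module R P by fact
  have R: "cring R" by unfold_locales
  let ?F = "free_module R (carrier P)"
  obtain p where p: "p \<in> module_hom R ?F P"
      "\<And>s. s \<in> carrier P \<Longrightarrow> p (free_basis R (carrier P) s) = s"
    by (rule free_module_hom_exists[OF P, of "\<lambda>s. s" "carrier P"]) auto
  have surj: "p ` carrier ?F = carrier P"
  proof (intro equalityI subsetI)
    fix x assume "x \<in> p ` carrier ?F"
    then show "x \<in> carrier P" using p(1) by (auto simp: module_hom_def)
  next
    fix x assume "x \<in> carrier P"
    then show "x \<in> p ` carrier ?F"
      using p(2) free_basis_closed[OF R] by (metis imageI)
  qed
  have "(\<lambda>x. x) \<in> module_hom R P P" by (simp add: module_hom_def)
  then obtain k where "k \<in> module_hom R P ?F" "\<forall>x\<in>carrier P. p (k x) = x"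
    using lift[OF free_module_module[OF R] P p(1) surj] by blast
  with P p(1) show ?thesis unfolding projective_module_def by blast
qed


section \<open>Complexes\<close>

text \<open>
  A complex has terms \<open>ob X i\<close> and differentials \<open>bd X i\<close> from \<open>ob X i\<close> to \<open>ob X (i - 1)\<close>,
  for all integers \<open>i\<close>.
\<close>

record ('r, 'p) cplx =
  ob :: "int \<Rightarrow> ('r, 'p) module"
  bd :: "int \<Rightarrow> 'p \<Rightarrow> 'p"

definition is_complex :: "('r, 'x) ring_scheme \<Rightarrow> ('r, 'p) cplx \<Rightarrow> bool"
  where "is_complex R X \<longleftrightarrow>
    (\<forall>i. module R (ob X i)) \<and>
    (\<forall>i. bd X i \<in> module_hom R (ob X i) (ob X (i - 1))) \<and>
    (\<forall>i. \<forall>x\<in>carrier (ob X i). bd X (i - 1) (bd X i x) = \<zero>\<^bsub>ob X (i - 2)\<^esub>)"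

definition cycles :: "('r, 'p) cplx \<Rightarrow> int \<Rightarrow> 'p set"
  where "cycles X i = {x \<in> carrier (ob X i). bd X i x = \<zero>\<^bsub>ob X (i - 1)\<^esub>}"

definition boundaries :: "('r, 'p) cplx \<Rightarrow> int \<Rightarrow> 'p set"
  where "boundaries X i = bd X (i + 1) ` carrier (ob X (i + 1))"

definition homology :: "('r, 'p) cplx \<Rightarrow> int \<Rightarrow> ('r, 'p set) module"
  where "homology X i = quot_module ((ob X i)\<lparr>carrier := cycles X i\<rparr>) (boundaries X i)"

text \<open>With the usual conventions for the empty set, the zero complex has \<open>csup = -\<infinity>\<close> and \<open>cinf = \<infinity>\<close>.\<close>

definition csup :: "('r, 'p) cplx \<Rightarrow> ereal"
  where "csup X = Sup {ereal (real_of_int i) | i. \<not> zero_module (ob X i)}"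

definition cinf :: "('r, 'p) cplx \<Rightarrow> ereal"
  where "cinf X = Inf {ereal (real_of_int i) | i. \<not> zero_module (ob X i)}"

definition hsup :: "('r, 'p) cplx \<Rightarrow> ereal"
  where "hsup X = Sup {ereal (real_of_int i) | i. \<not> zero_module (homology X i)}"

definition complex_length :: "('r, 'p) cplx \<Rightarrow> ereal"
  where "complex_length X = csup X - cinf X"

definition bounded_below :: "('r, 'p) cplx \<Rightarrow> bool"
  where "bounded_below X \<longleftrightarrow> (\<exists>b. \<forall>i<b. zero_module (ob X i))"

definition bounded_above :: "('r, 'p) cplx \<Rightarrow> bool"
  where "bounded_above X \<longleftrightarrow> (\<exists>b. \<forall>i>b. zero_module (ob X i))"


section \<open>Quasi-projective resolutions and dimension\<close>

definition quasi_projective_resolution ::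
    "('r, 'x) ring_scheme \<Rightarrow> ('r, 'm, 'y) module_scheme \<Rightarrow> ('r, 'p) cplx \<Rightarrow> bool"
  where "quasi_projective_resolution R M P \<longleftrightarrow>
    is_complex R P \<and> bounded_below P \<and> (\<forall>i. projective_module R (ob P i)) \<and>
    (\<exists>a :: int \<Rightarrow> nat.
       (\<forall>i. cinf P \<le> ereal (real_of_int i) \<longrightarrow>
            module_iso R (homology P i) (power_module M (a i))) \<and>
       (\<exists>i. cinf P \<le> ereal (real_of_int i) \<and> a i \<noteq> 0))"

definition finite_quasi_projective_resolution ::
    "('r, 'x) ring_scheme \<Rightarrow> ('r, 'm, 'y) module_scheme \<Rightarrow> ('r, 'p) cplx \<Rightarrow> bool"
  where "finite_quasi_projective_resolution R M P \<longleftrightarrow>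
    quasi_projective_resolution R M P \<and> bounded_above P"

text \<open>
  HOL cannot quantify over all modules of all types, so the type \<open>'p\<close> of the elements of the modules
  in the resolutions is a parameter (a universe). Enlarging \<open>'p\<close> can only decrease the value
  (an upper bound for a small universe is the stronger assertion), and the value is the absolute
  one as soon as \<open>'p\<close> has at least \<open>max |R| |M| \<aleph>\<^sub>0\<close> elements: projective modules are direct sums of
  countably generated ones, so every finite quasi-projective resolution of \<open>M\<close> contains one of that
  size with the same homology and hence no larger value of \<open>csup - hsup\<close>. In particular, for \<open>M = R/I\<close> the universe \<open>nat \<Rightarrow> 'r\<close> suffices.

  The value is meaningful for \<open>M \<noteq> 0\<close>; then \<open>hsup P\<close> and \<open>csup P\<close> are finite for each \<open>P\<close> in the set.
\<close>

definition qpd ::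
    "'p itself \<Rightarrow> ('r, 'x) ring_scheme \<Rightarrow> ('r, 'm, 'y) module_scheme \<Rightarrow> ereal"
  where "qpd U R M =
    Inf {csup P - hsup P | P :: ('r, 'p) cplx. finite_quasi_projective_resolution R M P}"


section \<open>Periodic modules\<close>

text \<open>
  \<open>'p\<close> is again the type of the elements of the modules in the resolution. Differentials are
  compared on carriers only, as HOL functions are unconstrained elsewhere.
\<close>

definition projective_resolution ::
    "('r, 'x) ring_scheme \<Rightarrow> ('r, 'm, 'y) module_scheme \<Rightarrow> ('r, 'p) cplx \<Rightarrow> bool"
  where "projective_resolution R M P \<longleftrightarrow>
    is_complex R P \<and> (\<forall>i. projective_module R (ob P i)) \<and> (\<forall>i<0. zero_module (ob P i)) \<and>
    (\<forall>i>0. zero_module (homology P i)) \<and> module_iso R (homology P 0) M"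

definition has_period ::
    "'p itself \<Rightarrow> ('r, 'x) ring_scheme \<Rightarrow> ('r, 'm, 'y) module_scheme \<Rightarrow> nat \<Rightarrow> bool"
  where "has_period U R M r \<longleftrightarrow> r > 0 \<and>
    (\<exists>P :: ('r, 'p) cplx. projective_resolution R M P \<and>
       (\<forall>i\<ge>0. ob P i = ob P (int r + i)) \<and>
       (\<forall>i\<ge>1. \<forall>x\<in>carrier (ob P i). bd P i x = bd P (int r + i) x))"

definition periodic_module ::
    "'p itself \<Rightarrow> ('r, 'x) ring_scheme \<Rightarrow> ('r, 'm, 'y) module_scheme \<Rightarrow> bool"
  where "periodic_module U R M \<longleftrightarrow> (\<exists>r. has_period U R M r)"

definition periodicity ::
    "'p itself \<Rightarrow> ('r, 'x) ring_scheme \<Rightarrow> ('r, 'm, 'y) module_scheme \<Rightarrow> nat"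
  where "periodicity U R M = (LEAST r. has_period U R M r)"


section \<open>Local rings\<close>

definition local_ring :: "('r, 'x) ring_scheme \<Rightarrow> bool"
  where "local_ring R \<longleftrightarrow> cring R \<and> (\<exists>!m. maximalideal m R)"

definition max_ideal :: "('r, 'x) ring_scheme \<Rightarrow> 'r set"
  where "max_ideal R = (THE m. maximalideal m R)"

text \<open>The residue field, regarded as an \<open>R\<close>-module.\<close>

definition residue_module :: "('r, 'x) ring_scheme \<Rightarrow> ('r, 'r set) module"
  where "residue_module R = quot_module (ring_as_module R) (max_ideal R)"

text \<open>
  The cotangent space \<open>m/m\<^sup>2\<close> as a vector space over \<open>R/m\<close>: the class of \<open>r\<close> times the class of \<open>x\<close>
  is the coset \<open>m\<^sup>2 + rx\<close>, which is what \<^const>\<open>rcoset_mult\<close> computes.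
\<close>

definition cotangent_space :: "('r, 'x) ring_scheme \<Rightarrow> ('r set, 'r set) module"
  where "cotangent_space R = (let m = max_ideal R; m2 = m \<cdot>\<^bsub>R\<^esub> m in
    \<lparr>carrier = a_rcosets\<^bsub>R\<lparr>carrier := m\<rparr>\<^esub> m2, mult = (\<lambda>_ _. m2), one = m2, zero = m2,
     add = set_add R, smult = rcoset_mult R m2\<rparr>)"

definition edim :: "('r, 'x) ring_scheme \<Rightarrow> enat"
  where "edim R = (let k = R Quot max_ideal R; V = cotangent_space R in
    if vectorspace.fin_dim k V then enat (vectorspace.dim k V) else \<infinity>)"

end

theory Submission
  imports Defs
begin

text \<open>
  For (1), the homology of the Koszul complex on generators of \<open>\<mm>\<close> is annihilated by \<open>\<mm>\<close>, because
  multiplication by each generator is null-homotopic, and finitely generated, because \<open>R\<close> is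
  noetherian; so it is a finite power of \<open>R/\<mm>\<close>. In the local case Nakayama's lemma lifts a smallest
  generating set of the cotangent space to \<open>edim R\<close> generators of \<open>\<mm>\<close>.

  For (2), a periodic resolution of \<open>M\<close> is truncated after two periods. The only homology of the
  truncation is \<open>M\<close> in degree \<open>0\<close> and a second copy of \<open>M\<close> in the top degree. One period would not
  do for \<open>r = 1\<close>, where both degrees would coincide.
\<close>

text \<open>A quasi-projective resolution may have homology in every degree, as long as it consists
  of powers of one module. This is why arbitrary generators of the maximal ideal suffice: the Koszul
  complex need not be exact anywhere. To bound \<open>csup - hsup\<close> it is enough that the
  homology in degree 0 survives. It does, since the degree 0 entry of a boundary is a combination of
  the generators and so cannot be 1. A module annihilated by a maximal ideal m is a vector space
  over R/m, but its homology classes come as elements of an R-module. The linear algebra is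
  therefore done with coefficients in R, reading "zero" as "in m" and "invertible" as "invertible
  modulo m". For periodic modules the value 0 is least possible because \<open>hsup\<close> never
  exceeds \<open>csup\<close>, and it is attained because the second copy of M sits in the highest
  degree of the truncation.\<close>

section \<open>Homomorphisms and isomorphisms of modules\<close>

lemma module_hom_closedD: "f \<in> module_hom R A B \<Longrightarrow> x \<in> carrier A \<Longrightarrow> f x \<in> carrier B"
  by (auto simp: module_hom_def)

lemma module_homI:
  assumes "\<And>x. x \<in> carrier A \<Longrightarrow> f x \<in> carrier B"
    and "\<And>x y. x \<in> carrier A \<Longrightarrow> y \<in> carrier A \<Longrightarrow> f (x \<oplus>\<^bsub>A\<^esub> y) = f x \<oplus>\<^bsub>B\<^esub> f y"
    and "\<And>r x. r \<in> carrier R \<Longrightarrow> x \<in> carrier A \<Longrightarrow> f (r \<odot>\<^bsub>A\<^esub> x) = r \<odot>\<^bsub>B\<^esub> f x"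
  shows "f \<in> module_hom R A B"
  using assms by (auto simp: module_hom_def)

lemma mod_homI: "module R A \<Longrightarrow> module R B \<Longrightarrow> f \<in> module_hom R A B \<Longrightarrow> mod_hom R A B f"
  by (simp add: mod_hom_def mod_hom_axioms_def)

lemma (in abelian_group) minus_eq_zero_iff:
  assumes "x \<in> carrier G" "y \<in> carrier G"
  shows "x \<ominus> y = \<zero> \<longleftrightarrow> x = y"
proof
  assume "x \<ominus> y = \<zero>"
  then have "(x \<ominus> y) \<oplus> y = y" using assms by simp
  then show "x = y" using assms by (simp add: a_minus_def a_assoc l_neg)
qed (use assms in \<open>simp add: a_minus_def r_neg\<close>)

lemma module_iso_sym:
  assumes "module R A" "module_iso R A B"
  shows "module_iso R B A"
proof -
  interpret module R A by fact
  obtain f where f: "f \<in> module_hom R A B" "bij_betw f (carrier A) (carrier B)"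
    using assms(2) by (auto simp: module_iso_def)
  let ?g = "inv_into (carrier A) f"
  have g: "bij_betw ?g (carrier B) (carrier A)"
    using f(2) by (rule bij_betw_inv_into)
  have cl: "?g y \<in> carrier A" if "y \<in> carrier B" for y
    using bij_betwE[OF g] that by blast
  have fg: "f (?g y) = y" if "y \<in> carrier B" for y
    using f(2) that by (rule bij_betw_inv_into_right)
  have gf: "?g (f x) = x" if "x \<in> carrier A" for x
    using f(2) that by (rule bij_betw_inv_into_left)
  have "?g \<in> module_hom R B A"
  proof (rule module_homI)
    fix x y assume xy: "x \<in> carrier B" "y \<in> carrier B"
    have "f (?g x \<oplus>\<^bsub>A\<^esub> ?g y) = x \<oplus>\<^bsub>B\<^esub> y"
      using xy by (simp add: module_hom_add[OF f(1)] cl fg)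
    then show "?g (x \<oplus>\<^bsub>B\<^esub> y) = ?g x \<oplus>\<^bsub>A\<^esub> ?g y"
      using gf[of "?g x \<oplus>\<^bsub>A\<^esub> ?g y"] xy by (simp add: cl)
  next
    fix r x assume rx: "r \<in> carrier R" "x \<in> carrier B"
    have "f (r \<odot>\<^bsub>A\<^esub> ?g x) = r \<odot>\<^bsub>B\<^esub> x"
      using rx by (simp add: module_hom_smult[OF f(1)] cl fg)
    then show "?g (r \<odot>\<^bsub>B\<^esub> x) = r \<odot>\<^bsub>A\<^esub> ?g x"
      using gf[of "r \<odot>\<^bsub>A\<^esub> ?g x"] rx by (simp add: cl)
  qed (rule cl)
  with g show ?thesis by (auto simp: module_iso_def)
qed

lemma module_iso_trans:
  assumes "module_iso R A B" "module_iso R B C"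
  shows "module_iso R A C"
proof -
  obtain f g where f: "f \<in> module_hom R A B" "bij_betw f (carrier A) (carrier B)"
      and g: "g \<in> module_hom R B C" "bij_betw g (carrier B) (carrier C)"
    using assms by (auto simp: module_iso_def)
  have "bij_betw (\<lambda>x. g (f x)) (carrier A) (carrier C)"
    using bij_betw_trans[OF f(2) g(2)] by (simp add: comp_def)
  moreover have "(\<lambda>x. g (f x)) \<in> module_hom R A C"
    using g(1) f(1) by (rule module_hom_comp)
  ultimately show ?thesis by (auto simp: module_iso_def)
qed

lemma zero_modules_iso:
  assumes "module R A" "module R B" "zero_module A" "zero_module B"
  shows "module_iso R A B"
proof -
  interpret A: module R A by fact
  interpret B: module R B by fact
  show ?thesis
    unfolding module_iso_def
    by (intro bexI[of _ "\<lambda>_. \<zero>\<^bsub>B\<^esub>"])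
      (use assms(3,4) in \<open>auto simp: zero_module_def module_hom_def bij_betw_def\<close>)
qed

lemma zero_module_iso:
  assumes "module R A" "module R B" "module_iso R A B"
  shows "zero_module A \<longleftrightarrow> zero_module B"
proof -
  obtain f where f: "f \<in> module_hom R A B" "bij_betw f (carrier A) (carrier B)"
    using assms by (auto simp: module_iso_def)
  interpret mod_hom R A B f by (rule mod_homI) fact+
  have B: "carrier B = f ` carrier A" and inj: "inj_on f (carrier A)"
    using f(2) by (auto simp: bij_betw_def)
  show ?thesis
  proof
    assume "zero_module A"
    then show "zero_module B" by (simp add: zero_module_def B)
  next
    assume "zero_module B"
    then have "f x = f \<zero>\<^bsub>A\<^esub>" if "x \<in> carrier A" for x
      using f_im[OF that] by (simp add: zero_module_def)
    then have "x = \<zero>\<^bsub>A\<^esub>" if "x \<in> carrier A" for x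
      using that inj by (metis inj_onD M.M.zero_closed)
    then show "zero_module A" by (auto simp: zero_module_def)
  qed
qed

section \<open>Quotient modules\<close>

text \<open>Negatives come from the scalar -1; the axioms of a submodule speak of sums, zero and
  scalar multiples only.\<close>

lemma submodule_uminus:
  assumes "LinearCombinations.submodule R N M" "x \<in> N"
  shows "\<ominus>\<^bsub>M\<^esub> x \<in> N"
proof -
  interpret N: LinearCombinations.submodule R N M by fact
  interpret module R M by (rule N.module)
  have "(\<ominus>\<^bsub>R\<^esub> \<one>\<^bsub>R\<^esub>) \<odot>\<^bsub>M\<^esub> x \<in> N"
    using assms(2) by simp
  with assms(2) N.subset show ?thesis
    by (simp add: smult_l_minus subsetD)
qed

lemma submodule_abelian_subgroup:
  assumes "LinearCombinations.submodule R N M"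
  shows "abelian_subgroup N M"
proof -
  interpret N: LinearCombinations.submodule R N M by fact
  interpret module R M by (rule N.module)
  have "subgroup N (add_monoid M)"
    using N.subset N.zero_closed submodule_uminus[OF assms]
    by (intro add.subgroupI) (auto simp: a_inv_def simp del: N.zero_closed)
  then show ?thesis
    by (intro abelian_subgroupI3 additive_subgroupI M.abelian_group_axioms)
qed

text \<open>Viewing the submodule as an additive subgroup makes the coset calculus of abelian groups
  available; what has to be added is the scalar multiplication.\<close>

locale module_quotient = N: LinearCombinations.submodule R N M + module R M for R N M
begin

sublocale abelian_subgroup N M
  by (rule submodule_abelian_subgroup) unfold_locales

lemma coset_carrier: "carrier (quot_module M N) = (\<lambda>x. N +>\<^bsub>M\<^esub> x) ` carrier M"
  by (auto simp: quot_module_def A_RCOSETS_def RCOSETS_def a_r_coset_def)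

lemma coset_closed: "x \<in> carrier M \<Longrightarrow> N +>\<^bsub>M\<^esub> x \<in> carrier (quot_module M N)"
  by (simp add: coset_carrier)

lemma coset_add:
  "x \<in> carrier M \<Longrightarrow> y \<in> carrier M \<Longrightarrow>
    (N +>\<^bsub>M\<^esub> x) \<oplus>\<^bsub>quot_module M N\<^esub> (N +>\<^bsub>M\<^esub> y) = N +>\<^bsub>M\<^esub> (x \<oplus>\<^bsub>M\<^esub> y)"
  by (simp add: quot_module_def a_rcos_sum)

lemma mem_coset_iff:
  assumes "x \<in> carrier M" "y \<in> carrier M"
  shows "x \<in> N +>\<^bsub>M\<^esub> y \<longleftrightarrow> x \<ominus>\<^bsub>M\<^esub> y \<in> N"
  using assms a_rcos_module[of y x] by (simp add: a_minus_def)

lemma coset_eq_iff: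
  assumes "x \<in> carrier M" "y \<in> carrier M"
  shows "N +>\<^bsub>M\<^esub> x = N +>\<^bsub>M\<^esub> y \<longleftrightarrow> x \<ominus>\<^bsub>M\<^esub> y \<in> N"
  using assms a_repr_independence'[of x y] a_repr_independenceD[of x y] mem_coset_iff
  by metis

lemma coset_zero: "N +>\<^bsub>M\<^esub> \<zero>\<^bsub>M\<^esub> = \<zero>\<^bsub>quot_module M N\<^esub>"
  using N.subset by (simp add: quot_module_def)

lemma coset_eq_zero_iff:
  assumes "x \<in> carrier M"
  shows "N +>\<^bsub>M\<^esub> x = \<zero>\<^bsub>quot_module M N\<^esub> \<longleftrightarrow> x \<in> N"
proof
  show "x \<in> N" if "N +>\<^bsub>M\<^esub> x = \<zero>\<^bsub>quot_module M N\<^esub>"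
    using a_rcos_self[OF assms] that by (simp add: quot_module_def)
  show "N +>\<^bsub>M\<^esub> x = \<zero>\<^bsub>quot_module M N\<^esub>" if "x \<in> N"
    using a_rcos_const[OF that] by (simp add: quot_module_def)
qed

text \<open>The union in \<open>quot_module\<close> runs over all representatives \<open>y\<close>
  of the coset. They all contribute the same coset because \<open>r (y - x)\<close> stays in
  \<open>N\<close>.\<close>

lemma coset_smult:
  assumes r: "r \<in> carrier R" and x: "x \<in> carrier M"
  shows "r \<odot>\<^bsub>quot_module M N\<^esub> (N +>\<^bsub>M\<^esub> x) = N +>\<^bsub>M\<^esub> (r \<odot>\<^bsub>M\<^esub> x)"
proof -
  have "N +>\<^bsub>M\<^esub> (r \<odot>\<^bsub>M\<^esub> y) = N +>\<^bsub>M\<^esub> (r \<odot>\<^bsub>M\<^esub> x)" if "y \<in> N +>\<^bsub>M\<^esub> x" for y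
  proof -
    have y: "y \<in> carrier M" by (rule a_elemrcos_carrier[OF x that])
    have "r \<odot>\<^bsub>M\<^esub> (y \<ominus>\<^bsub>M\<^esub> x) \<in> N"
      using that x y r by (intro N.smult_closed) (simp_all add: mem_coset_iff)
    then show ?thesis
      using x y r by (subst coset_eq_iff) (simp_all add: a_minus_def smult_r_distr smult_r_minus)
  qed
  then have "(\<Union>y\<in>N +>\<^bsub>M\<^esub> x. N +>\<^bsub>M\<^esub> (r \<odot>\<^bsub>M\<^esub> y)) = (\<Union>y\<in>N +>\<^bsub>M\<^esub> x. N +>\<^bsub>M\<^esub> (r \<odot>\<^bsub>M\<^esub> x))"
    by (rule SUP_cong[OF refl])
  also have "\<dots> = N +>\<^bsub>M\<^esub> (r \<odot>\<^bsub>M\<^esub> x)"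
    using a_rcos_self[OF x] by blast
  finally show ?thesis by (simp add: quot_module_def)
qed

lemma quot_module_module: "module R (quot_module M N)"
proof (intro moduleI abelian_groupI)
  let ?Q = "quot_module M N"
  show "cring R" by (rule is_cring)
  have cl: "\<exists>x\<in>carrier M. X = N +>\<^bsub>M\<^esub> x" if "X \<in> carrier ?Q" for X
    using that by (auto simp: coset_carrier)
  show "\<exists>y\<in>carrier ?Q. y \<oplus>\<^bsub>?Q\<^esub> x = \<zero>\<^bsub>?Q\<^esub>" if x: "x \<in> carrier ?Q" for x
  proof -
    obtain u where u: "u \<in> carrier M" "x = N +>\<^bsub>M\<^esub> u" using cl[OF x] by blast
    then show ?thesis
      by (intro bexI[of _ "N +>\<^bsub>M\<^esub> (\<ominus>\<^bsub>M\<^esub> u)"])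
        (simp_all add: coset_add coset_closed M.l_neg coset_zero del: a_coset_add_zero)
  qed
qed (auto simp: coset_carrier coset_add coset_smult coset_zero[symmetric]
       M.a_ac smult_l_distr smult_r_distr smult_assoc1 simp del: a_coset_add_zero)

lemma zero_quot_module_iff: "zero_module (quot_module M N) \<longleftrightarrow> carrier M \<subseteq> N"
proof -
  interpret Q: module R "quot_module M N" by (rule quot_module_module)
  have "zero_module (quot_module M N) \<longleftrightarrow> carrier (quot_module M N) \<subseteq> {\<zero>\<^bsub>quot_module M N\<^esub>}"
    unfolding zero_module_def using Q.M.zero_closed by blast
  also have "\<dots> \<longleftrightarrow> carrier M \<subseteq> N"
    unfolding coset_carrier by (auto simp: image_subset_iff coset_eq_zero_iff)
  finally show ?thesis .
qed

lemma first_iso: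
  assumes B: "module R B" and f: "f \<in> module_hom R M B" and surj: "f ` carrier M = carrier B"
    and ker: "\<And>x. x \<in> carrier M \<Longrightarrow> f x = \<zero>\<^bsub>B\<^esub> \<longleftrightarrow> x \<in> N"
  shows "module_iso R (quot_module M N) B"
proof -
  interpret B: module R B by fact
  have "module R M" ..
  then interpret F: mod_hom R M B f using B f by (rule mod_homI)
  \<comment> \<open>\<open>f\<close> is constant on each coset, so its image there is a
    singleton.\<close>
  define g where "g X = the_elem (f ` X)" for X
  have eq: "f x = f y \<longleftrightarrow> N +>\<^bsub>M\<^esub> x = N +>\<^bsub>M\<^esub> y" if "x \<in> carrier M" "y \<in> carrier M" for x y
  proof -
    have "f x = f y \<longleftrightarrow> f x \<ominus>\<^bsub>B\<^esub> f y = \<zero>\<^bsub>B\<^esub>"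
      by (rule B.minus_eq_zero_iff[symmetric]) (use that in auto)
    also have "\<dots> \<longleftrightarrow> f (x \<ominus>\<^bsub>M\<^esub> y) = \<zero>\<^bsub>B\<^esub>"
      using that by (simp only: F.f_minus)
    also have "\<dots> \<longleftrightarrow> x \<ominus>\<^bsub>M\<^esub> y \<in> N"
      by (rule ker) (use that in simp)
    also have "\<dots> \<longleftrightarrow> N +>\<^bsub>M\<^esub> x = N +>\<^bsub>M\<^esub> y"
      by (rule coset_eq_iff[symmetric]) (use that in auto)
    finally show ?thesis .
  qed
  have g: "g (N +>\<^bsub>M\<^esub> x) = f x" if x: "x \<in> carrier M" for x
  proof -
    have "f y = f x" if "y \<in> N +>\<^bsub>M\<^esub> x" for y
      using eq[OF a_elemrcos_carrier[OF x that] x] a_repr_independence'[OF that x] by blast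
    then have "f ` (N +>\<^bsub>M\<^esub> x) = {f x}" using a_rcos_self[OF x] by blast
    then show ?thesis by (simp add: g_def)
  qed
  have "g \<in> module_hom R (quot_module M N) B"
  proof (rule module_homI)
    fix X Y assume "X \<in> carrier (quot_module M N)" "Y \<in> carrier (quot_module M N)"
    then obtain x y where x: "x \<in> carrier M" "X = N +>\<^bsub>M\<^esub> x" and y: "y \<in> carrier M" "Y = N +>\<^bsub>M\<^esub> y"
      unfolding coset_carrier by blast
    have xy: "x \<oplus>\<^bsub>M\<^esub> y \<in> carrier M" using x y by simp
    show "g X \<in> carrier B" unfolding x(2) g[OF x(1)] using x(1) by (rule F.f_im)
    show "g (X \<oplus>\<^bsub>quot_module M N\<^esub> Y) = g X \<oplus>\<^bsub>B\<^esub> g Y"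
      unfolding x(2) y(2) coset_add[OF x(1) y(1)] g[OF x(1)] g[OF y(1)] g[OF xy]
      using x(1) y(1) by (rule F.f_add)
    fix r assume r: "r \<in> carrier R"
    have rx: "r \<odot>\<^bsub>M\<^esub> x \<in> carrier M" using r x(1) by simp
    show "g (r \<odot>\<^bsub>quot_module M N\<^esub> X) = r \<odot>\<^bsub>B\<^esub> g X"
      unfolding x(2) coset_smult[OF r x(1)] g[OF x(1)] g[OF rx]
      using r x(1) by (rule F.f_smult)
  qed
  moreover have "inj_on g (carrier (quot_module M N))"
    using eq g by (auto simp: inj_on_def coset_carrier)
  moreover have "g ` carrier (quot_module M N) = carrier B"
    using surj g by (simp add: coset_carrier image_image)
  ultimately show ?thesis by (auto simp: module_iso_def bij_betw_def)
qed

end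

section \<open>Homology\<close>

locale chain_complex =
  fixes R :: "('r, 'x) ring_scheme" and X :: "('r, 'p) cplx"
  assumes cplx: "is_complex R X"
begin

lemma ob_module: "module R (ob X i)" and bd_hom: "bd X i \<in> module_hom R (ob X i) (ob X (i - 1))"
  and bd_bd: "x \<in> carrier (ob X i) \<Longrightarrow> bd X (i - 1) (bd X i x) = \<zero>\<^bsub>ob X (i - 2)\<^esub>"
  using cplx by (auto simp: is_complex_def)

lemma bd_mod_hom: "mod_hom R (ob X i) (ob X (i - 1)) (bd X i)"
  by (intro mod_homI ob_module bd_hom)

lemma cycles_submodule: "LinearCombinations.submodule R (cycles X i) (ob X i)"
proof -
  interpret mod_hom R "ob X i" "ob X (i - 1)" "bd X i" by (rule bd_mod_hom)
  show ?thesis using ker_is_submodule by (simp add: ker_def cycles_def)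
qed

lemma cycles_module: "module R ((ob X i)\<lparr>carrier := cycles X i\<rparr>)"
  using module.submodule_is_module[OF ob_module cycles_submodule] .

lemma boundaries_subset: "boundaries X i \<subseteq> cycles X i"
  using bd_bd[of _ "i + 1"] module_hom_closedD[OF bd_hom[of "i + 1"]]
  by (auto simp: boundaries_def cycles_def)

lemma boundaries_submodule:
  "LinearCombinations.submodule R (boundaries X i) ((ob X i)\<lparr>carrier := cycles X i\<rparr>)"
proof -
  interpret mod_hom R "ob X (i + 1)" "ob X (i + 1 - 1)" "bd X (i + 1)" by (rule bd_mod_hom)
  interpret S: LinearCombinations.submodule R im "ob X (i + 1 - 1)" by (rule im_is_submodule)
  show ?thesis
    using cycles_module boundaries_subset S.m_closed S.zero_closed S.smult_closed
    unfolding LinearCombinations.submodule_def by (simp add: im_def boundaries_def)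
qed

text \<open>Homology in every degree inherits the coset calculus and
  \<open>first_iso\<close>.\<close>

sublocale H: module_quotient R "boundaries X i" "(ob X i)\<lparr>carrier := cycles X i\<rparr>" for i
  by (intro module_quotient.intro boundaries_submodule cycles_module)

lemma homology_module: "module R (homology X i)"
  unfolding homology_def by (rule H.quot_module_module)

lemma zero_homology_iff: "zero_module (homology X i) \<longleftrightarrow> cycles X i = boundaries X i"
  using boundaries_subset[of i] by (auto simp: homology_def H.zero_quot_module_iff)

lemma zero_homology: "zero_module (ob X i) \<Longrightarrow> zero_module (homology X i)"
  using boundaries_subset[of i] LinearCombinations.submodule.zero_closed[OF boundaries_submodule, of i]
  unfolding zero_homology_iff by (auto simp: zero_module_def cycles_def)

lemma hsup_le_csup: "hsup X \<le> csup X"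
  unfolding hsup_def csup_def by (rule Sup_subset_mono) (use zero_homology in blast)

end

section \<open>Zero modules and powers of modules\<close>

text \<open>A zero module is a retract of the free module on the empty set. This covers the terms
  that a truncation kills.\<close>

lemma zero_module_projective:
  fixes A :: "('r, 'p, 'y) module_scheme"
  assumes A: "module R A" and zero: "zero_module A"
  shows "projective_module R A"
proof -
  interpret A: module R A by fact
  have R: "cring R" by (rule A.is_cring)
  let ?F = "free_module R ({} :: 'p set)"
  interpret F: module R ?F by (rule free_module_module[OF R])
  have i: "(\<lambda>_. \<zero>\<^bsub>?F\<^esub>) \<in> module_hom R A ?F"
    by (rule module_homI) simp_all
  have p: "(\<lambda>_. \<zero>\<^bsub>A\<^esub>) \<in> module_hom R ?F A"
    by (rule module_homI) simp_all
  have "\<forall>x\<in>carrier A. \<zero>\<^bsub>A\<^esub> = x" using zero by (simp add: zero_module_def)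
  with A i p show ?thesis
    unfolding projective_module_def by (intro conjI exI)
qed

lemma zero_submodule_module:
  assumes "module R A"
  shows "module R (A\<lparr>carrier := {\<zero>\<^bsub>A\<^esub>}\<rparr>)"
proof -
  interpret A: module R A by fact
  show ?thesis
    by (rule A.submodule_is_module) (simp add: LinearCombinations.submodule_def assms)
qed

lemma zero_power_module: "zero_module (power_module M 0)"
  by (simp add: zero_module_def power_module_def restrict_def)

lemma power_module_module:
  assumes "module R M"
  shows "module R (power_module M a)"
proof -
  interpret M: module R M by fact
  show ?thesis
  proof (intro moduleI abelian_groupI)
    fix x assume x: "x \<in> carrier (power_module M a)"
    then show "\<exists>y\<in>carrier (power_module M a). y \<oplus>\<^bsub>power_module M a\<^esub> x = \<zero>\<^bsub>power_module M a\<^esub>"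
      by (intro bexI[of _ "\<lambda>j\<in>{..<a}. \<ominus>\<^bsub>M\<^esub> x j"])
        (auto simp: power_module_def PiE_iff M.M.l_neg intro!: restrict_ext)
    show "\<zero>\<^bsub>power_module M a\<^esub> \<oplus>\<^bsub>power_module M a\<^esub> x = x"
      using x by (intro extensionalityI[of _ "{..<a}"]) (auto simp: power_module_def PiE_iff)
    show "\<one>\<^bsub>R\<^esub> \<odot>\<^bsub>power_module M a\<^esub> x = x"
      using x by (intro extensionalityI[of _ "{..<a}"]) (auto simp: power_module_def PiE_iff)
  qed (auto simp: power_module_def PiE_iff M.M.a_ac M.is_cring M.smult_l_distr M.smult_r_distr
         M.smult_assoc1 intro!: restrict_ext)
qed

lemma power_module_1_iso:
  assumes "module R M"
  shows "module_iso R M (power_module M 1)"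
proof -
  interpret M: module R M by fact
  let ?f = "\<lambda>x. \<lambda>j\<in>{..<1::nat}. x"
  have "?f \<in> module_hom R M (power_module M 1)"
    by (rule module_homI) (auto simp: power_module_def)
  moreover have "bij_betw ?f (carrier M) (carrier (power_module M 1))"
    by (rule bij_betw_byWitness[where f' = "\<lambda>u. u 0"])
      (auto simp: power_module_def PiE_iff extensional_def fun_eq_iff split: if_splits)
  ultimately show ?thesis by (auto simp: module_iso_def)
qed

section \<open>Truncation and periodic modules\<close>

text \<open>\<open>N\<close> is the first degree that is killed, so the top degree is
  \<open>N - 1\<close>. Only the carrier is cut down: the zeros of the terms, on which
  \<open>cycles\<close> depends, stay as they were.\<close>

definition truncation :: "int \<Rightarrow> ('r, 'p) cplx \<Rightarrow> ('r, 'p) cplx"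
  where "truncation N P =
    \<lparr>ob = (\<lambda>i. if i < N then ob P i else (ob P i)\<lparr>carrier := {\<zero>\<^bsub>ob P i\<^esub>}\<rparr>),
     bd = (\<lambda>i. if i < N then bd P i else (\<lambda>_. \<zero>\<^bsub>ob P (i - 1)\<^esub>))\<rparr>"

context chain_complex
begin

lemma truncation_complex: "is_complex R (truncation N X)"
proof -
  have m: "module R (ob (truncation N X) i)" for i
    using ob_module zero_submodule_module[OF ob_module] by (simp add: truncation_def)
  have z: "\<zero>\<^bsub>ob (truncation N X) i\<^esub> = \<zero>\<^bsub>ob X i\<^esub>" for i by (simp add: truncation_def)
  have bd0: "bd X i \<zero>\<^bsub>ob X i\<^esub> = \<zero>\<^bsub>ob X (i - 1)\<^esub>" for i
    by (rule mod_hom.f0_is_0[OF bd_mod_hom])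
  have h: "bd (truncation N X) i \<in> module_hom R (ob (truncation N X) i) (ob (truncation N X) (i - 1))" for i
  proof (cases "i < N")
    case True
    then show ?thesis using bd_hom[of i] by (simp add: truncation_def)
  next
    case False
    interpret B: module R "ob (truncation N X) (i - 1)" by (rule m)
    have "bd (truncation N X) i = (\<lambda>_. \<zero>\<^bsub>ob (truncation N X) (i - 1)\<^esub>)"
      using False by (simp add: z) (simp add: truncation_def)
    then show ?thesis by (intro module_homI) simp_all
  qed
  have "bd (truncation N X) (i - 1) (bd (truncation N X) i x) = \<zero>\<^bsub>ob X (i - 2)\<^esub>"
    if "x \<in> carrier (ob (truncation N X) i)" for i x
    using that bd_bd[of x i] bd0[of "i - 1"] by (auto simp: truncation_def)
  with m h z show ?thesis by (simp add: is_complex_def)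
qed

text \<open>Homology in degree \<open>i\<close> involves the terms up to degree
  \<open>i + 1\<close>, hence the bound. Below it the records agree literally, so this is an
  equality and not just an isomorphism.\<close>

lemma homology_truncation: "i < N - 1 \<Longrightarrow> homology (truncation N X) i = homology X i"
  by (simp add: homology_def cycles_def boundaries_def truncation_def)

text \<open>Nothing enters the top degree any more, so the boundaries there are zero and the
  identity on cycles induces the isomorphism.\<close>

lemma homology_truncation_top:
  "module_iso R (homology (truncation N X) (N - 1)) ((ob X (N - 1))\<lparr>carrier := cycles X (N - 1)\<rparr>)"
proof -
  interpret T: chain_complex R "truncation N X"
    by unfold_locales (rule truncation_complex)
  let ?Z = "(ob X (N - 1))\<lparr>carrier := cycles X (N - 1)\<rparr>"
  have ob: "(ob (truncation N X) (N - 1))\<lparr>carrier := cycles (truncation N X) (N - 1)\<rparr> = ?Z"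
    by (simp add: truncation_def cycles_def)
  have bo: "boundaries (truncation N X) (N - 1) = {\<zero>\<^bsub>ob X (N - 1)\<^esub>}"
    by (simp add: truncation_def boundaries_def)
  show ?thesis
    unfolding homology_def ob
    by (rule module_quotient.first_iso[OF T.H.module_quotient_axioms[of "N - 1", unfolded ob],
          where f = "\<lambda>x. x"])
      (auto simp: cycles_module bo module_hom_def)
qed

end

lemma homology_cokernel:
  assumes "zero_module (ob P (i - 1))" "is_complex R P"
  shows "homology P i = quot_module (ob P i) (boundaries P i)"
proof -
  interpret chain_complex R P by unfold_locales fact
  have "bd P i x = \<zero>\<^bsub>ob P (i - 1)\<^esub>" if "x \<in> carrier (ob P i)" for x
    using module_hom_closedD[OF bd_hom that] assms(1) by (simp add: zero_module_def)
  then have "cycles P i = carrier (ob P i)" by (auto simp: cycles_def)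
  then show ?thesis by (simp add: homology_def)
qed

lemma qpd_nonneg: "0 \<le> qpd U R M"
  unfolding qpd_def
proof (rule Inf_greatest, safe)
  fix P assume "finite_quasi_projective_resolution R M P"
  then interpret chain_complex R P
    by unfold_locales (simp add: finite_quasi_projective_resolution_def quasi_projective_resolution_def)
  show "0 \<le> csup P - hsup P" using hsup_le_csup by (rule ereal_diff_positive)
qed

text \<open>The truncation has its highest nonzero term and its highest nonzero homology in the same
  degree, so it realizes the lower bound \<open>qpd_nonneg\<close>.\<close>

lemma periodic_qpd_eq_0:
  fixes M :: "('r, 'm, 'y) module_scheme"
  assumes M: "module R M" "\<not> zero_module M" and per: "has_period (U :: 'p itself) R M r"
  shows "qpd U R M = 0"
proof -
  obtain P :: "('r, 'p) cplx" where r: "r > 0" and P: "projective_resolution R M P"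
    and ob: "\<And>i. i \<ge> 0 \<Longrightarrow> ob P i = ob P (int r + i)"
    and bd: "\<And>i x. i \<ge> 1 \<Longrightarrow> x \<in> carrier (ob P i) \<Longrightarrow> bd P i x = bd P (int r + i) x"
    using per unfolding has_period_def by blast
  interpret chain_complex R P
    using P by unfold_locales (simp add: projective_resolution_def)
  have neg: "zero_module (ob P i)" if "i < 0" for i
    using P that by (simp add: projective_resolution_def)
  have pos: "zero_module (homology P i)" if "i > 0" for i
    using P that by (simp add: projective_resolution_def)
  have H0: "module_iso R (homology P 0) M"
    using P by (simp add: projective_resolution_def)
  define N where "N = 2 * int r"
  \<comment> \<open>This puts degree 0 strictly below the top degree \<open>N - 1\<close>, so its
    homology is unchanged by the truncation, and it makes the resolution exact in degree
    \<open>N - 1\<close>.\<close>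
  have N: "N \<ge> 2" using r by (simp add: N_def)
  have obN: "ob P (N + i) = ob P i" if "i \<ge> 0" for i
    using ob[OF that] ob[of "int r + i"] that by (simp add: N_def add.assoc)
  \<comment> \<open>Differentials repeat from degree 1 on only. Degree \<open>N + 1\<close> is
    compared with degree 1, whereas \<open>bd P N\<close> has no counterpart in degree 0; it plays
    the part of an augmentation.\<close>
  have bdN: "bd P (N + 1) x = bd P 1 x" if "x \<in> carrier (ob P 1)" for x
    using bd[of 1 x] bd[of "int r + 1" x] ob[of 1] that by (simp add: N_def add.assoc)
  define Q where "Q = truncation N P"
  interpret Q: chain_complex R Q
    unfolding Q_def by unfold_locales (rule truncation_complex)
  let ?Z = "(ob P (N - 1))\<lparr>carrier := cycles P (N - 1)\<rparr>"
  txt \<open>By periodicity the differential out of degree \<open>N\<close> has the kernel of the augmentation as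
    its kernel, so its image, the module of cycles in the top degree, is a copy of \<open>M\<close>.\<close>
  have im: "bd P N ` carrier (ob P 0) = cycles P (N - 1)"
    using pos[of "N - 1"] N obN[of 0] by (simp add: zero_homology_iff boundaries_def)
  have ker: "cycles P N = boundaries P 0"
  proof -
    have "cycles P N = bd P (N + 1) ` carrier (ob P 1)"
      using pos[of N] N obN[of 1] by (simp add: zero_homology_iff boundaries_def)
    also have "\<dots> = boundaries P 0" using bdN by (simp add: boundaries_def)
    finally show ?thesis .
  qed
  have Z: "module R ?Z" by (rule cycles_module)
  have coker: "homology P 0 = quot_module (ob P 0) (boundaries P 0)"
    using neg[of "-1"] cplx by (intro homology_cokernel) simp_all
  have "cycles P 0 = carrier (ob P 0)"
    using neg[of "-1"] module_hom_closedD[OF bd_hom[of 0]] by (auto simp: cycles_def zero_module_def)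
  then have mq: "module_quotient R (boundaries P 0) (ob P 0)"
    using H.module_quotient_axioms[of 0] by simp
  have "module_iso R (homology P 0) ?Z"
    unfolding coker
  proof (rule module_quotient.first_iso[OF mq Z])
    show "bd P N \<in> module_hom R (ob P 0) ?Z"
      using bd_hom[of N] obN[of 0] im by (auto simp: module_hom_def)
    show "bd P N x = \<zero>\<^bsub>?Z\<^esub> \<longleftrightarrow> x \<in> boundaries P 0" if "x \<in> carrier (ob P 0)" for x
      using that obN[of 0] by (auto simp: ker[symmetric] cycles_def)
  qed (simp add: im)
  then have "module_iso R ?Z (homology P 0)"
    by (rule module_iso_sym[OF homology_module])
  then have "module_iso R ?Z M"
    using H0 by (rule module_iso_trans)
  with homology_truncation_top have top: "module_iso R (homology Q (N - 1)) M"
    unfolding Q_def by (rule module_iso_trans)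
  have low: "homology Q i = homology P i" if "i < N - 1" for i
    using that by (simp add: Q_def homology_truncation)
  have obQ: "zero_module (ob Q i)" if "i < 0 \<or> i \<ge> N" for i
    using that neg N by (auto simp: Q_def truncation_def zero_module_def)
  define a where "a i = (if i = 0 \<or> i = N - 1 then 1 else 0 :: nat)" for i
  have homQ: "module_iso R (homology Q i) (power_module M (a i))" for i
  proof (cases "i = 0 \<or> i = N - 1")
    case True
    then have "module_iso R (homology Q i) M" using H0 top low[of 0] N by auto
    then have "module_iso R (homology Q i) (power_module M 1)"
      using power_module_1_iso[OF M(1)] by (rule module_iso_trans)
    then show ?thesis using True by (simp add: a_def)
  next
    case False
    then consider "i < 0" | "i > 0" "i < N - 1" | "i \<ge> N" by linarith
    then have "zero_module (homology Q i)"
      by cases (use obQ Q.zero_homology pos low in auto)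
    then have "module_iso R (homology Q i) (power_module M 0)"
      by (intro zero_modules_iso Q.homology_module power_module_module M zero_power_module)
    then show ?thesis using False by (simp add: a_def)
  qed
  have nzH: "\<not> zero_module (homology Q (N - 1))"
    using zero_module_iso[OF Q.homology_module M(1) top] M(2) by simp
  then have nz: "\<not> zero_module (ob Q (N - 1))" using Q.zero_homology by blast
  \<comment> \<open>A nonzero multiplicity is demanded in some degree not below
    \<open>cinf Q\<close>; degree \<open>N - 1\<close> will be the witness.\<close>
  have "cinf Q \<le> ereal (real_of_int (N - 1))"
    unfolding cinf_def by (rule Inf_lower) (use nz in blast)
  moreover have "projective_module R (ob Q i)" for i
  proof (cases "i < N")
    case True
    then show ?thesis using P by (simp add: Q_def truncation_def projective_resolution_def)
  qed (use zero_module_projective[OF Q.ob_module obQ] in simp)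
  moreover have "bounded_below Q" "bounded_above Q"
    unfolding bounded_below_def bounded_above_def using obQ by (auto intro: exI[of _ 0] exI[of _ N])
  ultimately have "finite_quasi_projective_resolution R M Q"
    unfolding finite_quasi_projective_resolution_def quasi_projective_resolution_def
    using Q.cplx homQ by (auto intro!: exI[of _ a] exI[of _ "N - 1"] simp: a_def[of "N - 1"])
  then have "qpd U R M \<le> csup Q - hsup Q"
    unfolding qpd_def by (intro Inf_lower) blast
  \<comment> \<open>A squeeze: \<open>N - 1 <= hsup Q <= csup Q <= N - 1\<close>.\<close>
  also have "csup Q - hsup Q = 0"
  proof -
    have "csup Q \<le> ereal (real_of_int (N - 1))"
      unfolding csup_def
    proof (rule Sup_least, safe)
      fix i assume "\<not> zero_module (ob Q i)"
      then have "i \<le> N - 1" using obQ[of i] by linarith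
      then show "ereal (real_of_int i) \<le> ereal (real_of_int (N - 1))"
        unfolding ereal_less_eq(3) of_int_le_iff .
    qed
    moreover have "ereal (real_of_int (N - 1)) \<le> hsup Q"
      unfolding hsup_def by (rule Sup_upper) (use nzH in blast)
    ultimately have "csup Q = ereal (real_of_int (N - 1))" "hsup Q = ereal (real_of_int (N - 1))"
      using Q.hsup_le_csup by (meson antisym order_trans)+
    then show ?thesis by simp
  qed
  finally show ?thesis using qpd_nonneg[of U R M] by (rule antisym)
qed

section \<open>Finitely generated modules annihilated by a maximal ideal\<close>

text \<open>This is the statement that R/m is a field, expressed by elements of \<open>R\<close>:
  the ideal m + (u) is strictly larger than m, hence contains 1.\<close>

lemma maximalideal_unit_mod:
  assumes R: "cring R" and m: "maximalideal m R" and u: "u \<in> carrier R" "u \<notin> m"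
  obtains s t where "s \<in> carrier R" "t \<in> m" "\<one>\<^bsub>R\<^esub> = t \<oplus>\<^bsub>R\<^esub> s \<otimes>\<^bsub>R\<^esub> u"
proof -
  interpret cring R by fact
  interpret m: maximalideal m R by fact
  let ?J = "m <+>\<^bsub>R\<^esub> PIdl\<^bsub>R\<^esub> u"
  have J: "ideal ?J R"
    using m.is_ideal cgenideal_ideal[OF u(1)] by (rule add_ideals)
  have mem: "?J = {t \<oplus>\<^bsub>R\<^esub> s \<otimes>\<^bsub>R\<^esub> u | t s. t \<in> m \<and> s \<in> carrier R}"
    by (auto simp: set_add_def' cgenideal_def)
  have "m \<subseteq> ?J"
    unfolding mem using u(1) by (force intro: exI[of _ "\<zero>\<^bsub>R\<^esub>"])
  moreover have "u \<in> ?J"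
    unfolding mem using u(1) m.zero_closed by (force intro: exI[of _ "\<zero>\<^bsub>R\<^esub>"] exI[of _ "\<one>\<^bsub>R\<^esub>"])
  moreover have "?J \<subseteq> carrier R" using J by (rule ideal.Icarr[THEN subsetI])
  ultimately have "?J = carrier R" using m.I_maximal[OF J] u(2) by blast
  then have "\<one>\<^bsub>R\<^esub> \<in> ?J" by simp
  then show thesis unfolding mem using that by blast
qed

text \<open>Allows annihilation by an ideal to be checked on its generators.\<close>

lemma (in module) annihilator_ideal:
  assumes x: "x \<in> carrier M"
  shows "ideal {r \<in> carrier R. r \<odot>\<^bsub>M\<^esub> x = \<zero>\<^bsub>M\<^esub>} R"
proof (rule idealI)
  let ?I = "{r \<in> carrier R. r \<odot>\<^bsub>M\<^esub> x = \<zero>\<^bsub>M\<^esub>}"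
  show "subgroup ?I (add_monoid R)"
  proof (rule R.add.subgroupI)
    have "\<zero>\<^bsub>R\<^esub> \<in> ?I" using x by simp
    then show "?I \<noteq> {}" by blast
  qed (use x in \<open>auto simp: smult_l_distr smult_l_minus\<close>)
  show "b \<otimes>\<^bsub>R\<^esub> a \<in> ?I" if "a \<in> ?I" "b \<in> carrier R" for a b
    using that x by (simp add: smult_assoc1)
  then show "a \<otimes>\<^bsub>R\<^esub> b \<in> ?I" if "a \<in> ?I" "b \<in> carrier R" for a b
    using that R.m_comm[of a b] by simp
qed (rule R.ring_axioms)

lemma ring_as_module_module:
  assumes "cring R"
  shows "module R (ring_as_module R)"
proof -
  interpret cring R by fact
  show ?thesis
    by (intro moduleI abelian_groupI)
      (auto simp: ring_as_module_def a_ac m_assoc l_distr r_distr is_cring intro: bexI[of _ "\<ominus>\<^bsub>R\<^esub> x" for x] l_neg)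
qed

lemma ideal_submodule:
  assumes "cring R" "ideal I R"
  shows "LinearCombinations.submodule R I (ring_as_module R)"
proof -
  interpret ideal I R by fact
  show ?thesis
    using ring_as_module_module[OF assms(1)] a_subset
    by (simp add: LinearCombinations.submodule_def) (simp add: ring_as_module_def I_l_closed)
qed

lemma residue_module_quotient:
  assumes "cring R" "ideal I R"
  shows "module_quotient R I (ring_as_module R)"
  using assms by (simp add: module_quotient_def ideal_submodule ring_as_module_module)

section \<open>Linear combinations and bases modulo a maximal ideal\<close>

text \<open>Coefficients are addressed by position in the list, which makes the coefficient families
  elements of a \<open>power_module\<close>; the recursion supports induction on the
  generators.\<close>

primrec lin_comb :: "('r, 'p, 'y) module_scheme \<Rightarrow> 'p list \<Rightarrow> (nat \<Rightarrow> 'r) \<Rightarrow> 'p"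
  where "lin_comb M [] u = \<zero>\<^bsub>M\<^esub>"
  | "lin_comb M (h # hs) u = u 0 \<odot>\<^bsub>M\<^esub> h \<oplus>\<^bsub>M\<^esub> lin_comb M hs (\<lambda>j. u (Suc j))"

lemma lin_comb_cong:
  "(\<And>j. j < length hs \<Longrightarrow> u j = v j) \<Longrightarrow> lin_comb M hs u = lin_comb M hs v"
proof (induction hs arbitrary: u v)
  case (Cons h hs)
  have "lin_comb M hs (\<lambda>j. u (Suc j)) = lin_comb M hs (\<lambda>j. v (Suc j))"
    by (rule Cons.IH) (simp add: Cons.prems)
  then show ?case using Cons.prems[of 0] by simp
qed simp

context module
begin

lemma lin_comb_closed:
  "set hs \<subseteq> carrier M \<Longrightarrow> (\<And>j. j < length hs \<Longrightarrow> u j \<in> carrier R) \<Longrightarrow> lin_comb M hs u \<in> carrier M"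
proof (induction hs arbitrary: u)
  case (Cons h hs)
  then show ?case
    using Cons.IH[of "\<lambda>j. u (Suc j)"] Cons.prems(2)[of 0] by simp
qed simp

lemma lin_comb_add:
  assumes "set hs \<subseteq> carrier M"
    and "\<And>j. j < length hs \<Longrightarrow> u j \<in> carrier R" and "\<And>j. j < length hs \<Longrightarrow> v j \<in> carrier R"
  shows "lin_comb M hs (\<lambda>j. u j \<oplus>\<^bsub>R\<^esub> v j) = lin_comb M hs u \<oplus>\<^bsub>M\<^esub> lin_comb M hs v"
  using assms
proof (induction hs arbitrary: u v)
  case (Cons h hs)
  have h: "h \<in> carrier M" "u 0 \<in> carrier R" "v 0 \<in> carrier R"
    using Cons.prems(1) Cons.prems(2,3)[of 0] by auto
  have "lin_comb M hs (\<lambda>j. u (Suc j)) \<in> carrier M" "lin_comb M hs (\<lambda>j. v (Suc j)) \<in> carrier M"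
    using Cons.prems by (auto intro: lin_comb_closed)
  then show ?case
    using h Cons.IH[of "\<lambda>j. u (Suc j)" "\<lambda>j. v (Suc j)"] Cons.prems
    by (simp add: smult_l_distr M.a_ac)
qed simp

lemma lin_comb_smult:
  assumes "set hs \<subseteq> carrier M" "r \<in> carrier R" and "\<And>j. j < length hs \<Longrightarrow> u j \<in> carrier R"
  shows "lin_comb M hs (\<lambda>j. r \<otimes>\<^bsub>R\<^esub> u j) = r \<odot>\<^bsub>M\<^esub> lin_comb M hs u"
  using assms
proof (induction hs arbitrary: u)
  case (Cons h hs)
  have h: "h \<in> carrier M" "u 0 \<in> carrier R"
    using Cons.prems(1) Cons.prems(3)[of 0] by auto
  have "lin_comb M hs (\<lambda>j. u (Suc j)) \<in> carrier M"
    using Cons.prems by (auto intro: lin_comb_closed)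
  then show ?case
    using h Cons.IH[of "\<lambda>j. u (Suc j)"] Cons.prems
    by (simp add: smult_r_distr smult_assoc1)
qed simp

definition lin_combs :: "'c list \<Rightarrow> 'c set"
  where "lin_combs hs = {lin_comb M hs u | u. \<forall>j<length hs. u j \<in> carrier R}"

lemma lin_combs_submodule:
  assumes hs: "set hs \<subseteq> carrier M"
  shows "LinearCombinations.submodule R (lin_combs hs) M"
proof (unfold_locales, goal_cases)
  case 1
  show ?case unfolding lin_combs_def using lin_comb_closed[OF hs] by blast
next
  case (2 v w)
  then obtain u u' where "\<forall>j<length hs. u j \<in> carrier R" "v = lin_comb M hs u"
      "\<forall>j<length hs. u' j \<in> carrier R" "w = lin_comb M hs u'"
    unfolding lin_combs_def by blast
  then show ?case
    unfolding lin_combs_def using lin_comb_add[OF hs, of u u']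
    by (auto intro!: exI[of _ "\<lambda>j. u j \<oplus>\<^bsub>R\<^esub> u' j"])
next
  case 3
  have "lin_comb M hs (\<lambda>j. \<zero>\<^bsub>R\<^esub> \<otimes>\<^bsub>R\<^esub> \<zero>\<^bsub>R\<^esub>) = \<zero>\<^bsub>M\<^esub>"
    using lin_comb_closed[OF hs, of "\<lambda>_. \<zero>\<^bsub>R\<^esub>"] by (subst lin_comb_smult[OF hs]) simp_all
  then show ?case unfolding lin_combs_def by (auto intro!: exI[of _ "\<lambda>j. \<zero>\<^bsub>R\<^esub>"])
next
  case (4 c v)
  then obtain u where "\<forall>j<length hs. u j \<in> carrier R" "v = lin_comb M hs u"
    unfolding lin_combs_def by blast
  then show ?case
    unfolding lin_combs_def using 4(1) lin_comb_smult[OF hs, of c u]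
    by (auto intro!: exI[of _ "\<lambda>j. c \<otimes>\<^bsub>R\<^esub> u j"])
qed

lemma lin_combs_Cons:
  assumes "set (h # hs) \<subseteq> carrier M"
  shows "h \<in> lin_combs (h # hs)" "lin_combs hs \<subseteq> lin_combs (h # hs)"
proof -
  have h: "h \<in> carrier M" and hs: "set hs \<subseteq> carrier M" using assms by auto
  interpret S: LinearCombinations.submodule R "lin_combs hs" M using hs by (rule lin_combs_submodule)
  have *: "c \<odot>\<^bsub>M\<^esub> h \<oplus>\<^bsub>M\<^esub> v \<in> lin_combs (h # hs)" if c: "c \<in> carrier R" and v: "v \<in> lin_combs hs" for c v
  proof -
    obtain u where u: "\<forall>j<length hs. u j \<in> carrier R" "v = lin_comb M hs u"
      using v unfolding lin_combs_def by blast
    show ?thesis unfolding lin_combs_def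
      by (rule CollectI, rule exI[of _ "case_nat c u"]) (use u c in \<open>auto split: nat.split\<close>)
  qed
  show "h \<in> lin_combs (h # hs)" using *[OF R.one_closed S.zero_closed] h by simp
  show "lin_combs hs \<subseteq> lin_combs (h # hs)"
  proof
    fix v assume v: "v \<in> lin_combs hs"
    then have "v \<in> carrier M" using S.subset by blast
    then show "v \<in> lin_combs (h # hs)" using *[OF R.zero_closed v] h by simp
  qed
qed

text \<open>Selection of a basis over R/m, phrased over \<open>R\<close>: independence says that the
  coefficients of a vanishing combination lie in m. A generator already in the span is skipped. Any
  other one is added, since a coefficient outside m in front of it would be invertible modulo m and
  would put it into the span after all.\<close>

lemma basis_mod_maximalideal:
  assumes m: "maximalideal m R"
    and ann: "\<And>r x. r \<in> m \<Longrightarrow> x \<in> carrier M \<Longrightarrow> r \<odot>\<^bsub>M\<^esub> x = \<zero>\<^bsub>M\<^esub>"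
    and gs: "set gs \<subseteq> carrier M"
  shows "\<exists>hs. set hs \<subseteq> carrier M \<and> set gs \<subseteq> lin_combs hs \<and>
    (\<forall>u. (\<forall>j<length hs. u j \<in> carrier R) \<and> lin_comb M hs u = \<zero>\<^bsub>M\<^esub> \<longrightarrow> (\<forall>j<length hs. u j \<in> m))"
  using gs
proof (induction gs)
  case Nil
  show ?case by (rule exI[of _ "[]"]) simp
next
  case (Cons g gs)
  interpret m: maximalideal m R by fact
  have g: "g \<in> carrier M" using Cons.prems by simp
  obtain hs where hs: "set hs \<subseteq> carrier M" "set gs \<subseteq> lin_combs hs"
    and ind: "\<And>u. (\<And>j. j < length hs \<Longrightarrow> u j \<in> carrier R) \<Longrightarrow> lin_comb M hs u = \<zero>\<^bsub>M\<^esub> \<Longrightarrow> (\<forall>j<length hs. u j \<in> m)"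
    using Cons.IH Cons.prems by auto
  interpret S: LinearCombinations.submodule R "lin_combs hs" M using hs(1) by (rule lin_combs_submodule)
  show ?case
  proof (cases "g \<in> lin_combs hs")
    case True
    then show ?thesis using hs ind by (intro exI[of _ hs]) simp
  next
    case False
    have sub: "set (g # hs) \<subseteq> carrier M" using g hs(1) by simp
    have "u j \<in> m" if u: "\<forall>j<length (g # hs). u j \<in> carrier R" "lin_comb M (g # hs) u = \<zero>\<^bsub>M\<^esub>"
        and j: "j < length (g # hs)" for u j
    proof -
      have u0: "u 0 \<in> carrier R" and u': "\<And>j. j < length hs \<Longrightarrow> u (Suc j) \<in> carrier R"
        using u(1) by auto
      let ?v = "lin_comb M hs (\<lambda>j. u (Suc j))"
      have v: "?v \<in> lin_combs hs" unfolding lin_combs_def using u' by blast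
      then have vM: "?v \<in> carrier M" using S.subset by blast
      have "u 0 \<odot>\<^bsub>M\<^esub> g \<oplus>\<^bsub>M\<^esub> ?v = \<zero>\<^bsub>M\<^esub>" using u(2) by simp
      then have ug: "u 0 \<odot>\<^bsub>M\<^esub> g = \<ominus>\<^bsub>M\<^esub> ?v"
        using u0 g vM by (simp add: M.minus_equality M.a_comm)
      have "u 0 \<in> m"
      proof (rule ccontr)
        assume "u 0 \<notin> m"
        then obtain s t where st: "s \<in> carrier R" "t \<in> m" "\<one>\<^bsub>R\<^esub> = t \<oplus>\<^bsub>R\<^esub> s \<otimes>\<^bsub>R\<^esub> u 0"
          using maximalideal_unit_mod[OF is_cring m u0] by blast
        have t: "t \<in> carrier R" using st(2) by (rule m.Icarr)
        have "g = (t \<oplus>\<^bsub>R\<^esub> s \<otimes>\<^bsub>R\<^esub> u 0) \<odot>\<^bsub>M\<^esub> g" using g by (simp flip: st(3))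
        also have "\<dots> = s \<odot>\<^bsub>M\<^esub> (u 0 \<odot>\<^bsub>M\<^esub> g)"
          using g t st(1) u0 ann[OF st(2) g] by (simp add: smult_l_distr smult_assoc1)
        also have "\<dots> \<in> lin_combs hs"
          unfolding ug using st(1) submodule_uminus[OF S.submodule_axioms v] by (rule S.smult_closed)
        finally show False using False by simp
      qed
      \<comment> \<open>The coefficient in m kills \<open>g\<close>, so the relation shrinks to one
        among \<open>hs\<close>.\<close>
      then have "?v = \<zero>\<^bsub>M\<^esub>" using u(2) ann[of "u 0" g] g vM by simp
      then have "\<forall>j<length hs. u (Suc j) \<in> m" using u' by (intro ind)
      with \<open>u 0 \<in> m\<close> j show ?thesis by (cases j) auto
    qed
    then show ?thesis
      using sub hs(2) lin_combs_Cons[OF sub] by (intro exI[of _ "g # hs"]) auto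
  qed
qed

end

text \<open>\<open>M\<close> and the power of R/m are quotients of the same free module
  \<open>R^a\<close> by the same submodule \<open>K\<close>, the tuples with all entries in m: the
  power by reduction in each coordinate, \<open>M\<close> by the independence of \<open>hs\<close>.
  Generation is expressed through submodules containing \<open>A\<close>, the form in which it is
  obtained for homology.\<close>

lemma annihilated_iso_power:
  assumes M: "module R M" and m: "maximalideal m R"
    and ann: "\<And>r x. r \<in> m \<Longrightarrow> x \<in> carrier M \<Longrightarrow> r \<odot>\<^bsub>M\<^esub> x = \<zero>\<^bsub>M\<^esub>"
    and fin: "finite A" and A: "A \<subseteq> carrier M"
    and gen: "\<And>N. LinearCombinations.submodule R N M \<Longrightarrow> A \<subseteq> N \<Longrightarrow> carrier M \<subseteq> N"
  shows "\<exists>a. module_iso R M (power_module (quot_module (ring_as_module R) m) a)"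
proof -
  interpret module R M by fact
  interpret m: maximalideal m R by fact
  let ?R = "ring_as_module R"
  interpret Q: module_quotient R m ?R
    using is_cring m.is_ideal by (rule residue_module_quotient)
  obtain gs where gs: "set gs = A" using finite_list[OF fin] by blast
  obtain hs where hs: "set hs \<subseteq> carrier M" "A \<subseteq> lin_combs hs"
    and ind: "\<And>u. (\<And>j. j < length hs \<Longrightarrow> u j \<in> carrier R) \<Longrightarrow> lin_comb M hs u = \<zero>\<^bsub>M\<^esub> \<Longrightarrow> (\<forall>j<length hs. u j \<in> m)"
    using basis_mod_maximalideal[OF m ann, of gs] A gs by auto
  have all: "carrier M \<subseteq> lin_combs hs"
    using lin_combs_submodule[OF hs(1)] hs(2) by (rule gen)
  let ?a = "length hs"
  let ?F = "power_module ?R ?a" and ?P = "power_module (quot_module ?R m) ?a"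
  have F: "module R ?F" by (intro power_module_module ring_as_module_module is_cring)
  have P: "module R ?P" by (intro power_module_module Q.quot_module_module)
  have Fc: "carrier ?F = {..<?a} \<rightarrow>\<^sub>E carrier R" by (simp add: power_module_def ring_as_module_def)
  have Rc: "carrier ?R = carrier R" by (simp add: ring_as_module_def)
  define K where "K = {u \<in> carrier ?F. \<forall>j<?a. u j \<in> m}"
  define f where "f = (\<lambda>u::nat \<Rightarrow> _. \<lambda>j\<in>{..<?a}. m +>\<^bsub>?R\<^esub> u j)"
  have f: "f \<in> module_hom R ?F ?P"
  proof (rule module_homI)
    show "f u \<in> carrier ?P" if "u \<in> carrier ?F" for u
      using that by (auto simp: f_def power_module_def PiE_iff Q.coset_closed)
    show "f (u \<oplus>\<^bsub>?F\<^esub> v) = f u \<oplus>\<^bsub>?P\<^esub> f v" if "u \<in> carrier ?F" "v \<in> carrier ?F" for u v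
      using that by (auto simp: f_def power_module_def PiE_iff Q.coset_add intro!: restrict_ext)
    show "f (r \<odot>\<^bsub>?F\<^esub> u) = r \<odot>\<^bsub>?P\<^esub> f u" if "r \<in> carrier R" "u \<in> carrier ?F" for u r
      using that by (auto simp: f_def power_module_def PiE_iff Q.coset_smult intro!: restrict_ext)
  qed
  have f0: "f u = \<zero>\<^bsub>?P\<^esub> \<longleftrightarrow> u \<in> K" if u: "u \<in> carrier ?F" for u
  proof -
    have "f u = \<zero>\<^bsub>?P\<^esub> \<longleftrightarrow> (\<forall>j<?a. m +>\<^bsub>?R\<^esub> u j = \<zero>\<^bsub>quot_module ?R m\<^esub>)"
      by (auto simp: f_def power_module_def fun_eq_iff restrict_def)
    also have "\<dots> \<longleftrightarrow> (\<forall>j<?a. u j \<in> m)"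
      using u by (auto simp: Fc PiE_iff Q.coset_eq_zero_iff Rc)
    finally show ?thesis using u by (simp add: K_def)
  qed
  have fsurj: "f ` carrier ?F = carrier ?P"
  proof (intro equalityI subsetI)
    fix w assume w: "w \<in> carrier ?P"
    then have "\<forall>j<?a. \<exists>x\<in>carrier R. w j = m +>\<^bsub>?R\<^esub> x"
      by (auto simp: power_module_def PiE_iff Q.coset_carrier Rc)
    then obtain u where u: "\<And>j. j < ?a \<Longrightarrow> u j \<in> carrier R \<and> w j = m +>\<^bsub>?R\<^esub> u j" by metis
    have "w = f (\<lambda>j\<in>{..<?a}. u j)"
      by (rule extensionalityI[of _ "{..<?a}"]) (use w u in \<open>auto simp: f_def power_module_def PiE_iff\<close>)
    moreover have "(\<lambda>j\<in>{..<?a}. u j) \<in> carrier ?F" using u by (auto simp: Fc)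
    ultimately show "w \<in> f ` carrier ?F" by blast
  qed (use module_hom_closedD[OF f] in auto)
  interpret f: mod_hom R ?F ?P f using F P f by (rule mod_homI)
  have "K = f.ker" using f0 by (auto simp: f.ker_def K_def)
  then have "LinearCombinations.submodule R K ?F" using f.ker_is_submodule by simp
  then have K: "module_quotient R K ?F" using F by (rule module_quotient.intro)
  have g: "lin_comb M hs \<in> module_hom R ?F M"
  proof (rule module_homI)
    show "lin_comb M hs u \<in> carrier M" if "u \<in> carrier ?F" for u
      using that by (intro lin_comb_closed hs) (auto simp: Fc)
    show "lin_comb M hs (u \<oplus>\<^bsub>?F\<^esub> v) = lin_comb M hs u \<oplus>\<^bsub>M\<^esub> lin_comb M hs v"
      if "u \<in> carrier ?F" "v \<in> carrier ?F" for u v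
    proof -
      have "lin_comb M hs (u \<oplus>\<^bsub>?F\<^esub> v) = lin_comb M hs (\<lambda>j. u j \<oplus>\<^bsub>R\<^esub> v j)"
        by (rule lin_comb_cong) (simp add: power_module_def ring_as_module_def)
      then show ?thesis using that by (subst lin_comb_add[OF hs(1), symmetric]) (auto simp: Fc)
    qed
    show "lin_comb M hs (r \<odot>\<^bsub>?F\<^esub> u) = r \<odot>\<^bsub>M\<^esub> lin_comb M hs u"
      if "r \<in> carrier R" "u \<in> carrier ?F" for u r
    proof -
      have "lin_comb M hs (r \<odot>\<^bsub>?F\<^esub> u) = lin_comb M hs (\<lambda>j. r \<otimes>\<^bsub>R\<^esub> u j)"
        by (rule lin_comb_cong) (simp add: power_module_def ring_as_module_def)
      then show ?thesis using that by (subst lin_comb_smult[OF hs(1), symmetric]) (auto simp: Fc)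
    qed
  qed
  have g0: "lin_comb M hs u = \<zero>\<^bsub>M\<^esub> \<longleftrightarrow> u \<in> K" if u: "u \<in> carrier ?F" for u
  proof
    assume "lin_comb M hs u = \<zero>\<^bsub>M\<^esub>"
    then show "u \<in> K" using ind[of u] u by (auto simp: K_def Fc)
  next
    \<comment> \<open>The easy inclusion: every single term vanishes because m annihilates
      \<open>M\<close>. The list is generalized for the induction.\<close>
    have "(\<forall>j<length ks. v j \<in> m) \<Longrightarrow> set ks \<subseteq> carrier M \<Longrightarrow> lin_comb M ks v = \<zero>\<^bsub>M\<^esub>" for ks v
    proof (induction ks arbitrary: v)
      case (Cons k ks)
      then show ?case using Cons.IH[of "\<lambda>j. v (Suc j)"] ann[of "v 0" k] by auto
    qed simp
    then show "u \<in> K \<Longrightarrow> lin_comb M hs u = \<zero>\<^bsub>M\<^esub>" using hs(1) by (simp add: K_def)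
  qed
  have gsurj: "lin_comb M hs ` carrier ?F = carrier M"
  proof (intro equalityI subsetI)
    fix x assume "x \<in> carrier M"
    then obtain u where u: "\<forall>j<?a. u j \<in> carrier R" "x = lin_comb M hs u"
      using all unfolding lin_combs_def by blast
    have "x = lin_comb M hs (\<lambda>j\<in>{..<?a}. u j)"
      unfolding u(2) by (rule lin_comb_cong) simp
    moreover have "(\<lambda>j\<in>{..<?a}. u j) \<in> carrier ?F" using u by (auto simp: Fc)
    ultimately show "x \<in> lin_comb M hs ` carrier ?F" by blast
  qed (use module_hom_closedD[OF g] in auto)
  have "module_iso R (quot_module ?F K) ?P"
    using P f fsurj f0 by (rule module_quotient.first_iso[OF K])
  moreover have "module_iso R M (quot_module ?F K)"
    using module_quotient.first_iso[OF K M g gsurj g0]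
    by (rule module_iso_sym[OF module_quotient.quot_module_module[OF K]])
  ultimately show ?thesis using module_iso_trans by blast
qed

section \<open>The Koszul complex\<close>

text \<open>
  The complex on \<open>x # xs\<close> is the mapping cone of multiplication by \<open>x\<close> on the complex on \<open>xs\<close>. A
  chain is a function on \<^typ>\<open>nat\<close> whose even and odd parts are the two summands of the cone, so the
  binary digits of an index encode a subset of the sequence, and \<open>koszul_index n i\<close> consists of the
  numbers below \<open>2 ^ n\<close> with \<open>i\<close> binary digits \<open>1\<close>.
\<close>

primrec koszul_index :: "nat \<Rightarrow> int \<Rightarrow> nat set"
  where "koszul_index 0 i = (if i = 0 then {0} else {})"
  | "koszul_index (Suc n) i =
      {t. if even t then t div 2 \<in> koszul_index n i else t div 2 \<in> koszul_index n (i - 1)}"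

text \<open>On a chain with even part \<open>a\<close> and odd part \<open>b\<close> this is
  \<open>d (a, b) = (d a + x b, - d b)\<close>, which is contraction in the exterior algebra. The
  sign makes the mixed terms of \<open>d d\<close> cancel. The degree does not enter the formula, so
  one function serves in all degrees.\<close>

primrec koszul_bd :: "('r, 'x) ring_scheme \<Rightarrow> 'r list \<Rightarrow> (nat \<Rightarrow> 'r) \<Rightarrow> nat \<Rightarrow> 'r"
  where "koszul_bd R [] u t = \<zero>\<^bsub>R\<^esub>"
  | "koszul_bd R (x # xs) u t =
      (if even t then koszul_bd R xs (\<lambda>s. u (2 * s)) (t div 2) \<oplus>\<^bsub>R\<^esub> x \<otimes>\<^bsub>R\<^esub> u (Suc t)
       else \<ominus>\<^bsub>R\<^esub> koszul_bd R xs (\<lambda>s. u (Suc (2 * s))) (t div 2))"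

text \<open>Exterior multiplication by the \<open>j\<close>-th basis vector: for the head of the
  list it is \<open>h (a, b) = (0, a)\<close>, and for a later entry it is
  \<open>h (a, b) = (h a, - h b)\<close>, the sign coming from moving past the first basis
  vector.\<close>

primrec koszul_homotopy ::
    "('r, 'x) ring_scheme \<Rightarrow> 'r list \<Rightarrow> nat \<Rightarrow> (nat \<Rightarrow> 'r) \<Rightarrow> nat \<Rightarrow> 'r"
  where "koszul_homotopy R [] j u t = \<zero>\<^bsub>R\<^esub>"
  | "koszul_homotopy R (x # xs) j u t = (case j of
        0 \<Rightarrow> if even t then \<zero>\<^bsub>R\<^esub> else u (t - 1)
      | Suc i \<Rightarrow> if even t then koszul_homotopy R xs i (\<lambda>s. u (2 * s)) (t div 2)
                else \<ominus>\<^bsub>R\<^esub> koszul_homotopy R xs i (\<lambda>s. u (Suc (2 * s))) (t div 2))"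

lemma finite_koszul_index: "finite (koszul_index n i)"
proof (induction n arbitrary: i)
  case (Suc n)
  have "koszul_index (Suc n) i \<subseteq> (\<lambda>s. 2 * s) ` koszul_index n i \<union> (\<lambda>s. Suc (2 * s)) ` koszul_index n (i - 1)"
  proof
    fix t assume "t \<in> koszul_index (Suc n) i"
    then show "t \<in> (\<lambda>s. 2 * s) ` koszul_index n i \<union> (\<lambda>s. Suc (2 * s)) ` koszul_index n (i - 1)"
      by (cases "even t") (auto elim!: evenE oddE)
  qed
  then show ?case by (rule finite_subset) (intro finite_UnI finite_imageI Suc)
qed simp

text \<open>Splitting by parity gives the recursion of Pascal's triangle. The range of nonempty
  degrees determines the length of the Koszul complex.\<close>

lemma koszul_index_nonempty_iff: "koszul_index n i \<noteq> {} \<longleftrightarrow> 0 \<le> i \<and> i \<le> int n"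
proof (induction n arbitrary: i)
  case (Suc n)
  have "koszul_index (Suc n) i \<noteq> {} \<longleftrightarrow> koszul_index n i \<noteq> {} \<or> koszul_index n (i - 1) \<noteq> {}"
  proof
    assume "koszul_index (Suc n) i \<noteq> {}"
    then show "koszul_index n i \<noteq> {} \<or> koszul_index n (i - 1) \<noteq> {}" by (auto split: if_splits)
  next
    have "2 * s \<in> koszul_index (Suc n) i" if "s \<in> koszul_index n i" for s
      using that by simp
    moreover have "Suc (2 * s) \<in> koszul_index (Suc n) i" if "s \<in> koszul_index n (i - 1)" for s
      using that by simp
    ultimately show "koszul_index n i \<noteq> {} \<or> koszul_index n (i - 1) \<noteq> {} \<Longrightarrow> koszul_index (Suc n) i \<noteq> {}"
      by blast
  qed
  then show ?case unfolding Suc.IH by auto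
qed simp

section \<open>Identities for the Koszul differential and the homotopies\<close>

context cring
begin

lemma koszul_bd_closed: "set xs \<subseteq> carrier R \<Longrightarrow> (\<And>t. u t \<in> carrier R) \<Longrightarrow> koszul_bd R xs u t \<in> carrier R"
  by (induction xs arbitrary: u t) auto

lemma koszul_homotopy_closed: "(\<And>t. u t \<in> carrier R) \<Longrightarrow> koszul_homotopy R xs j u t \<in> carrier R"
  by (induction xs arbitrary: j u t) (auto split: nat.split)

text \<open>One induction covers sums (\<open>r = 1\<close>), scalar multiples
  (\<open>u = 0\<close>) and negatives (\<open>u = 0\<close>, \<open>r = - 1\<close>).\<close>

lemma koszul_bd_lin:
  assumes "set xs \<subseteq> carrier R" "\<And>t. u t \<in> carrier R" "\<And>t. v t \<in> carrier R" "r \<in> carrier R"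
  shows "koszul_bd R xs (\<lambda>t. u t \<oplus> r \<otimes> v t) t = koszul_bd R xs u t \<oplus> r \<otimes> koszul_bd R xs v t"
  using assms
proof (induction xs arbitrary: u v t)
  case (Cons x xs)
  then have x: "x \<in> carrier R" "set xs \<subseteq> carrier R" by auto
  have cl: "koszul_bd R xs (\<lambda>s. u (k s)) t \<in> carrier R" "koszul_bd R xs (\<lambda>s. v (k s)) t \<in> carrier R" for k t
    using Cons.prems x by (auto intro!: koszul_bd_closed)
  show ?case
  proof (cases "even t")
    case True
    have "koszul_bd R xs (\<lambda>s. u (2 * s) \<oplus> r \<otimes> v (2 * s)) (t div 2) =
        koszul_bd R xs (\<lambda>s. u (2 * s)) (t div 2) \<oplus> r \<otimes> koszul_bd R xs (\<lambda>s. v (2 * s)) (t div 2)"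
      using Cons.prems x by (intro Cons.IH) auto
    then show ?thesis
      using True Cons.prems x cl[of "\<lambda>s. 2 * s" "t div 2"] by (simp add: r_distr a_ac m_ac)
  next
    case False
    have "koszul_bd R xs (\<lambda>s. u (Suc (2 * s)) \<oplus> r \<otimes> v (Suc (2 * s))) (t div 2) =
        koszul_bd R xs (\<lambda>s. u (Suc (2 * s))) (t div 2) \<oplus> r \<otimes> koszul_bd R xs (\<lambda>s. v (Suc (2 * s))) (t div 2)"
      using Cons.prems x by (intro Cons.IH) auto
    then show ?thesis
      using False Cons.prems x cl[of "\<lambda>s. Suc (2 * s)" "t div 2"] by (simp add: minus_add r_minus)
  qed
qed simp

lemma koszul_homotopy_lin:
  assumes "\<And>t. u t \<in> carrier R" "\<And>t. v t \<in> carrier R" "r \<in> carrier R"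
  shows "koszul_homotopy R xs j (\<lambda>t. u t \<oplus> r \<otimes> v t) t =
    koszul_homotopy R xs j u t \<oplus> r \<otimes> koszul_homotopy R xs j v t"
  using assms
proof (induction xs arbitrary: j u v t)
  case (Cons x xs)
  show ?case
  proof (cases j)
    case 0
    then show ?thesis using Cons.prems by simp
  next
    case (Suc i)
    have cl: "koszul_homotopy R xs i (\<lambda>s. u (k s)) t \<in> carrier R"
        "koszul_homotopy R xs i (\<lambda>s. v (k s)) t \<in> carrier R" for k t
      using Cons.prems by (auto intro!: koszul_homotopy_closed)
    have "koszul_homotopy R xs i (\<lambda>s. u (k s) \<oplus> r \<otimes> v (k s)) t =
        koszul_homotopy R xs i (\<lambda>s. u (k s)) t \<oplus> r \<otimes> koszul_homotopy R xs i (\<lambda>s. v (k s)) t" for k t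
      using Cons.prems by (intro Cons.IH) auto
    then show ?thesis
      using Suc Cons.prems(3) cl by (simp add: minus_add r_minus)
  qed
qed simp

lemma koszul_bd_zero:
  assumes "set xs \<subseteq> carrier R"
  shows "koszul_bd R xs (\<lambda>_. \<zero>) t = \<zero>"
  using assms by (induction xs arbitrary: t) auto

lemma koszul_homotopy_zero: "koszul_homotopy R xs j (\<lambda>_. \<zero>) t = \<zero>"
  by (induction xs arbitrary: j t) (auto split: nat.split)

lemma koszul_bd_minus:
  assumes "set xs \<subseteq> carrier R" "\<And>t. u t \<in> carrier R"
  shows "koszul_bd R xs (\<lambda>t. \<ominus> u t) t = \<ominus> koszul_bd R xs u t"
  using koszul_bd_lin[OF assms(1), of "\<lambda>_. \<zero>" u "\<ominus> \<one>" t] koszul_bd_closed[of xs u t] assms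
  by (simp add: koszul_bd_zero l_minus)

lemma koszul_homotopy_minus:
  assumes "\<And>t. u t \<in> carrier R"
  shows "koszul_homotopy R xs j (\<lambda>t. \<ominus> u t) t = \<ominus> koszul_homotopy R xs j u t"
  using koszul_homotopy_lin[of "\<lambda>_. \<zero>" u "\<ominus> \<one>" xs j t] koszul_homotopy_closed[of u xs j t] assms
  by (simp add: koszul_homotopy_zero l_minus)

lemma koszul_bd_bd:
  assumes "set xs \<subseteq> carrier R" "\<And>t. u t \<in> carrier R"
  shows "koszul_bd R xs (koszul_bd R xs u) t = \<zero>"
  using assms
proof (induction xs arbitrary: u t)
  case (Cons x xs)
  then have x: "x \<in> carrier R" and xs: "set xs \<subseteq> carrier R" by auto
  have cl: "koszul_bd R xs (\<lambda>s. u (k s)) t \<in> carrier R" for k t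
    using Cons.prems xs by (auto intro!: koszul_bd_closed)
  have bb: "koszul_bd R xs (koszul_bd R xs (\<lambda>s. u (k s))) t = \<zero>" for k t
    using Cons.prems xs by (intro Cons.IH)
  show ?case
  proof (cases "even t")
    case True
    have "koszul_bd R xs (\<lambda>s. koszul_bd R xs (\<lambda>s. u (2 * s)) s \<oplus> x \<otimes> u (Suc (2 * s))) (t div 2) =
        \<zero> \<oplus> x \<otimes> koszul_bd R xs (\<lambda>s. u (Suc (2 * s))) (t div 2)"
      using Cons.prems xs x cl by (subst koszul_bd_lin) (simp_all add: bb)
    then show ?thesis using True x cl by (simp add: r_minus r_neg)
  next
    case False
    have "koszul_bd R xs (\<lambda>s. \<ominus> koszul_bd R xs (\<lambda>s. u (Suc (2 * s))) s) (t div 2) = \<zero>"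
      using xs cl by (subst koszul_bd_minus) (simp_all add: bb)
    then show ?thesis using False by simp
  qed
qed simp

text \<open>For the head, \<open>d (0, a) = (x a, - d a)\<close> and
  \<open>h (d a + x b, - d b) = (0, d a + x b)\<close> add up to \<open>(x a, x b)\<close>. For
  later entries the claim holds in each part by induction, up to mixed terms with \<open>x\<close>
  in the even part.\<close>

lemma koszul_homotopy_bd:
  assumes "set xs \<subseteq> carrier R" "\<And>t. u t \<in> carrier R" "j < length xs"
  shows "koszul_bd R xs (koszul_homotopy R xs j u) t \<oplus> koszul_homotopy R xs j (koszul_bd R xs u) t
    = xs ! j \<otimes> u t"
  using assms
proof (induction xs arbitrary: j u t)
  case (Cons x xs)
  then have x: "x \<in> carrier R" and xs: "set xs \<subseteq> carrier R" by auto
  have cl: "koszul_bd R xs (\<lambda>s. u (k s)) t \<in> carrier R" for k t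
    using Cons.prems xs by (auto intro!: koszul_bd_closed)
  show ?case
  proof (cases j)
    case 0
    show ?thesis
    proof (cases "even t")
      case True
      then show ?thesis using 0 x Cons.prems(2) by (simp add: koszul_bd_zero[OF xs])
    next
      case False
      then obtain k where k: "t = Suc (2 * k)" by (auto elim: oddE)
      show ?thesis using 0 x Cons.prems(2) cl[of "\<lambda>s. 2 * s" k]
        by (simp add: k r_neg2 r_neg1 flip: a_assoc) (simp add: l_neg)
    qed
  next
    case (Suc i)
    have hcl: "koszul_homotopy R xs i (\<lambda>s. u (k s)) t \<in> carrier R" for k t
      using Cons.prems by (auto intro!: koszul_homotopy_closed)
    have hbcl: "koszul_homotopy R xs i (koszul_bd R xs (\<lambda>s. u (k s))) t \<in> carrier R" for k t
      using cl by (auto intro!: koszul_homotopy_closed)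
    have bhcl: "koszul_bd R xs (koszul_homotopy R xs i (\<lambda>s. u (k s))) t \<in> carrier R" for k t
      using hcl xs by (auto intro!: koszul_bd_closed)
    have IH: "koszul_bd R xs (koszul_homotopy R xs i (\<lambda>s. u (k s))) t
        \<oplus> koszul_homotopy R xs i (koszul_bd R xs (\<lambda>s. u (k s))) t = xs ! i \<otimes> u (k t)" for k t
      using Cons.prems Suc xs by (intro Cons.IH) auto
    show ?thesis
    proof (cases "even t")
      case True
      then obtain k where k: "t = 2 * k" by (auto elim: evenE)
      have "koszul_homotopy R xs i (\<lambda>s. koszul_bd R xs (\<lambda>s. u (2 * s)) s \<oplus> x \<otimes> u (Suc (2 * s))) k =
          koszul_homotopy R xs i (koszul_bd R xs (\<lambda>s. u (2 * s))) k
          \<oplus> x \<otimes> koszul_homotopy R xs i (\<lambda>s. u (Suc (2 * s))) k"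
        using Cons.prems(2) x cl by (intro koszul_homotopy_lin)
      \<comment> \<open>Here \<open>B\<close> is the homotopy applied to the odd part. It occurs
        twice through the summand with \<open>x\<close> in the differential, with opposite signs
        because the homotopy negates the odd part.\<close>
      moreover have "(A \<oplus> \<ominus> (x \<otimes> B)) \<oplus> (C \<oplus> x \<otimes> B) = A \<oplus> C"
        if "A \<in> carrier R" "B \<in> carrier R" "C \<in> carrier R" for A B C
        using that x by algebra
      ultimately show ?thesis
        using Suc x hcl hbcl bhcl IH[of "\<lambda>s. 2 * s" k] by (simp add: k r_minus)
    next
      case False
      then obtain k where k: "t = Suc (2 * k)" by (auto elim: oddE)
      have "koszul_bd R xs (\<lambda>s. \<ominus> koszul_homotopy R xs i (\<lambda>s. u (Suc (2 * s))) s) k =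
          \<ominus> koszul_bd R xs (koszul_homotopy R xs i (\<lambda>s. u (Suc (2 * s)))) k"
        using xs hcl by (intro koszul_bd_minus)
      moreover have "koszul_homotopy R xs i (\<lambda>s. \<ominus> koszul_bd R xs (\<lambda>s. u (Suc (2 * s))) s) k =
          \<ominus> koszul_homotopy R xs i (koszul_bd R xs (\<lambda>s. u (Suc (2 * s)))) k"
        using cl by (intro koszul_homotopy_minus)
      ultimately show ?thesis
        using Suc hcl hbcl bhcl IH[of "\<lambda>s. Suc (2 * s)" k] by (simp add: k)
    qed
  qed
qed simp

text \<open>The degree of a chain is visible only in its support. The odd part of a chain of degree
  \<open>i\<close> has degree \<open>i - 1\<close>, which is the shift in the induction.\<close>

lemma koszul_bd_support:
  assumes "set xs \<subseteq> carrier R" "\<And>t. t \<notin> koszul_index (length xs) i \<Longrightarrow> u t = \<zero>"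
    and "t \<notin> koszul_index (length xs) (i - 1)"
  shows "koszul_bd R xs u t = \<zero>"
  using assms
proof (induction xs arbitrary: i u t)
  case (Cons x xs)
  then have x: "x \<in> carrier R" "set xs \<subseteq> carrier R" by auto
  show ?case
  proof (cases "even t")
    case True
    have "koszul_bd R xs (\<lambda>s. u (2 * s)) (t div 2) = \<zero>"
      using x True Cons.prems by (intro Cons.IH[of i]) auto
    moreover have "u (Suc t) = \<zero>"
      using True Cons.prems by (intro Cons.prems(2)) auto
    ultimately show ?thesis using True x by simp
  next
    case False
    have "koszul_bd R xs (\<lambda>s. u (Suc (2 * s))) (t div 2) = \<zero>"
      using x False Cons.prems by (intro Cons.IH[of "i - 1"]) auto
    then show ?thesis using False by simp
  qed
qed simp

lemma koszul_homotopy_support: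
  assumes "\<And>t. t \<notin> koszul_index (length xs) i \<Longrightarrow> u t = \<zero>"
    and "t \<notin> koszul_index (length xs) (i + 1)"
  shows "koszul_homotopy R xs j u t = \<zero>"
  using assms
proof (induction xs arbitrary: i j u t)
  case (Cons x xs)
  show ?case
  proof (cases j)
    case 0
    then show ?thesis using Cons.prems by (auto elim!: oddE)
  next
    case (Suc l)
    show ?thesis
    proof (cases "even t")
      case True
      have "koszul_homotopy R xs l (\<lambda>s. u (2 * s)) (t div 2) = \<zero>"
        using True Cons.prems by (intro Cons.IH[of i]) auto
      then show ?thesis using True Suc by simp
    next
      case False
      have "koszul_homotopy R xs l (\<lambda>s. u (Suc (2 * s))) (t div 2) = \<zero>"
        using False Cons.prems by (intro Cons.IH[of "i - 1"]) auto
      then show ?thesis using False Suc by simp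
    qed
  qed
qed simp

text \<open>Index 0 stands for the empty subset, where a boundary is a linear combination of the
  sequence. This keeps 1 from being a boundary in degree 0.\<close>

lemma koszul_bd_0_mem:
  assumes "ideal I R" "set xs \<subseteq> I" "\<And>t. u t \<in> carrier R"
  shows "koszul_bd R xs u 0 \<in> I"
proof -
  interpret I: ideal I R by fact
  show ?thesis
    using assms(2,3) by (induction xs arbitrary: u) (auto simp: I.I_r_closed)
qed

end

section \<open>Modules of functions with prescribed support\<close>

text \<open>For finite \<open>S\<close> a free module. Its elements are total functions vanishing
  off \<open>S\<close>, unlike those of \<open>free_module\<close>, so the operations and the Koszul
  formulas do not depend on \<open>S\<close>.\<close>

definition supp_module :: "('r, 'x) ring_scheme \<Rightarrow> nat set \<Rightarrow> ('r, nat \<Rightarrow> 'r) module"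
  where "supp_module R S =
    \<lparr>carrier = {u. (\<forall>t. u t \<in> carrier R) \<and> (\<forall>t. t \<notin> S \<longrightarrow> u t = \<zero>\<^bsub>R\<^esub>)},
     mult = (\<lambda>_ _ _. \<zero>\<^bsub>R\<^esub>), one = (\<lambda>_. \<zero>\<^bsub>R\<^esub>), zero = (\<lambda>_. \<zero>\<^bsub>R\<^esub>),
     add = (\<lambda>u v t. u t \<oplus>\<^bsub>R\<^esub> v t), smult = (\<lambda>r u t. r \<otimes>\<^bsub>R\<^esub> u t)\<rparr>"

lemma supp_module_simps [simp]:
  "u \<in> carrier (supp_module R S) \<longleftrightarrow> (\<forall>t. u t \<in> carrier R) \<and> (\<forall>t. t \<notin> S \<longrightarrow> u t = \<zero>\<^bsub>R\<^esub>)"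
  "\<zero>\<^bsub>supp_module R S\<^esub> = (\<lambda>_. \<zero>\<^bsub>R\<^esub>)"
  "u \<oplus>\<^bsub>supp_module R S\<^esub> v = (\<lambda>t. u t \<oplus>\<^bsub>R\<^esub> v t)"
  "r \<odot>\<^bsub>supp_module R S\<^esub> u = (\<lambda>t. r \<otimes>\<^bsub>R\<^esub> u t)"
  by (simp_all add: supp_module_def)

lemma supp_module_module:
  assumes "cring R"
  shows "module R (supp_module R S)"
proof -
  interpret cring R by fact
  show ?thesis
  proof (intro moduleI abelian_groupI)
    show "\<exists>y\<in>carrier (supp_module R S). y \<oplus>\<^bsub>supp_module R S\<^esub> u = \<zero>\<^bsub>supp_module R S\<^esub>"
      if "u \<in> carrier (supp_module R S)" for u
      using that by (intro bexI[of _ "\<lambda>t. \<ominus>\<^bsub>R\<^esub> u t"]) (auto simp: l_neg)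
  qed (auto simp: a_ac m_assoc l_distr r_distr is_cring)
qed

text \<open>In \<open>projective_module\<close> the basis has the type of the elements of
  \<open>P\<close>; here its type is arbitrary, as needed for a basis of numbers in a module of
  functions. The lifting property, checked on the basis, bridges the difference.\<close>

lemma retract_of_free_projective:
  fixes P :: "('r, 'p) module" and S :: "'s set"
  assumes P: "module R P" and i: "i \<in> module_hom R P (free_module R S)"
    and p: "p \<in> module_hom R (free_module R S) P" and pi: "\<And>x. x \<in> carrier P \<Longrightarrow> p (i x) = x"
  shows "projective_module R P"
proof (rule lifting_projective[OF P])
  fix A :: "('r, 'p \<Rightarrow> 'r) module" and B :: "('r, 'p) module" and f g
  assume A: "module R A" and B: "module R B" and f: "f \<in> module_hom R A B" "f ` carrier A = carrier B"
    and g: "g \<in> module_hom R P B"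
  interpret module R P by fact
  note gp = module_hom_comp[OF g p]
  have "\<exists>a\<in>carrier A. f a = g (p (free_basis R S s))" if "s \<in> S" for s
    using module_hom_closedD[OF gp free_basis_closed[OF is_cring that]] f(2) by (metis imageE)
  then obtain a where a: "\<And>s. s \<in> S \<Longrightarrow> a s \<in> carrier A"
      "\<And>s. s \<in> S \<Longrightarrow> f (a s) = g (p (free_basis R S s))" by metis
  obtain k where k: "k \<in> module_hom R (free_module R S) A"
      "\<And>s. s \<in> S \<Longrightarrow> k (free_basis R S s) = a s"
    by (rule free_module_hom_exists[OF A, of a S]) (use a in auto)
  have "f (k u) = g (p u)" if "u \<in> carrier (free_module R S)" for u
    by (rule free_module_hom_eqI[OF is_cring B module_hom_comp[OF f(1) k(1)] gp _ that])
      (simp add: k a)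
  then have "\<forall>x\<in>carrier P. f (k (i x)) = g x"
    using module_hom_closedD[OF i] pi by simp
  then show "\<exists>k\<in>module_hom R P A. \<forall>x\<in>carrier P. f (k x) = g x"
    using module_hom_comp[OF k(1) i] by (rule bexI)
qed

lemma supp_module_projective:
  assumes R: "cring R" and S: "finite S"
  shows "projective_module R (supp_module R S)"
proof (rule retract_of_free_projective[where S = S])
  interpret cring R by fact
  show "module R (supp_module R S)" using R by (rule supp_module_module)
  show "(\<lambda>u. restrict u S) \<in> module_hom R (supp_module R S) (free_module R S)"
    using S by (intro module_homI) (auto simp: free_module_simps[OF R] intro!: restrict_ext)
  show "(\<lambda>v t. if t \<in> S then v t else \<zero>\<^bsub>R\<^esub>) \<in> module_hom R (free_module R S) (supp_module R S)"
    by (intro module_homI) (auto simp: free_module_simps[OF R] PiE_iff)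
  show "(\<lambda>t. if t \<in> S then restrict u S t else \<zero>\<^bsub>R\<^esub>) = u" if "u \<in> carrier (supp_module R S)" for u
    using that by auto
qed

text \<open>Places all these modules in one ambient module, so that the index set can vary in an
  induction.\<close>

lemma supp_module_mono:
  assumes N: "LinearCombinations.submodule R N (supp_module R S)"
  shows "LinearCombinations.submodule R N (supp_module R UNIV)"
proof -
  interpret N: LinearCombinations.submodule R N "supp_module R S" by fact
  have "cring R" using N.module by (rule module.axioms)
  then show ?thesis
    using N.subset N.m_closed N.zero_closed N.smult_closed
    by (auto simp: LinearCombinations.submodule_def intro!: supp_module_module)
qed

lemma evaluation_ideal:
  assumes N: "LinearCombinations.submodule R N (supp_module R UNIV)"
  shows "ideal ((\<lambda>u. u t) ` N) R"
proof -
  interpret N: LinearCombinations.submodule R N "supp_module R UNIV" by fact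
  interpret W: module R "supp_module R UNIV" by (rule N.module)
  have cl: "u t \<in> carrier R" if "u \<in> N" for u using N.subset that by auto
  have sm: "r \<otimes>\<^bsub>R\<^esub> u t \<in> (\<lambda>u. u t) ` N" if "r \<in> carrier R" "u \<in> N" for r u
    using N.smult_closed[OF that] by (auto intro: rev_image_eqI)
  show ?thesis
  proof (rule idealI)
    show "subgroup ((\<lambda>u. u t) ` N) (add_monoid R)"
    proof (rule W.R.add.subgroupI)
      show "(\<lambda>u. u t) ` N \<subseteq> carrier R" using cl by blast
      show "(\<lambda>u. u t) ` N \<noteq> {}" using N.zero_closed by blast
    next
      fix a assume "a \<in> (\<lambda>u. u t) ` N"
      then obtain u where u: "u \<in> N" "a = u t" by blast
      have "\<ominus>\<^bsub>R\<^esub> a = (\<ominus>\<^bsub>R\<^esub> \<one>\<^bsub>R\<^esub>) \<otimes>\<^bsub>R\<^esub> u t" using cl u by (simp add: W.R.l_minus)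
      then show "\<ominus>\<^bsub>R\<^esub> a \<in> (\<lambda>u. u t) ` N"
        using sm[of "\<ominus>\<^bsub>R\<^esub> \<one>\<^bsub>R\<^esub>" u] u by simp
    next
      fix a b assume "a \<in> (\<lambda>u. u t) ` N" "b \<in> (\<lambda>u. u t) ` N"
      then obtain u v where "u \<in> N" "a = u t" "v \<in> N" "b = v t" by blast
      then show "a \<oplus>\<^bsub>R\<^esub> b \<in> (\<lambda>u. u t) ` N"
        using N.m_closed[of u v] by (auto intro: rev_image_eqI)
    qed
    show "x \<otimes>\<^bsub>R\<^esub> a \<in> (\<lambda>u. u t) ` N" if "a \<in> (\<lambda>u. u t) ` N" "x \<in> carrier R" for a x
      using that sm by auto
    then show "a \<otimes>\<^bsub>R\<^esub> x \<in> (\<lambda>u. u t) ` N" if "a \<in> (\<lambda>u. u t) ` N" "x \<in> carrier R" for a x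
      using that cl W.R.m_comm by fastforce
  qed (rule W.R.ring_axioms)
qed

lemma submodule_Int:
  assumes "LinearCombinations.submodule R N M" "LinearCombinations.submodule R N' M"
  shows "LinearCombinations.submodule R (N \<inter> N') M"
  using assms by (auto simp: LinearCombinations.submodule_def)

text \<open>
  The finitely generated ideal of the values at \<open>t\<close> reduces the claim from \<open>insert t S\<close> to \<open>S\<close>.
\<close>

lemma noetherian_submodule_finitely_generated:
  assumes R: "cring R" "noetherian_ring R" and S: "finite S"
    and N: "LinearCombinations.submodule R N (supp_module R UNIV)"
    and supp: "\<And>u t. u \<in> N \<Longrightarrow> t \<notin> S \<Longrightarrow> u t = \<zero>\<^bsub>R\<^esub>"
  shows "\<exists>A. finite A \<and> A \<subseteq> N \<and>
    (\<forall>N'. LinearCombinations.submodule R N' (supp_module R UNIV) \<longrightarrow> A \<subseteq> N' \<longrightarrow> N \<subseteq> N')"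
  using S N supp
proof (induction S arbitrary: N)
  case empty
  have N: "N \<subseteq> {\<zero>\<^bsub>supp_module R UNIV\<^esub>}" using empty.prems(2) by auto
  show ?case
  proof (intro exI[of _ "{}"] conjI allI impI)
    fix N' assume "LinearCombinations.submodule R N' (supp_module R UNIV)"
    then show "N \<subseteq> N'" using N LinearCombinations.submodule.zero_closed by blast
  qed simp_all
next
  case (insert t S)
  interpret noetherian_ring R by fact
  let ?W = "supp_module R UNIV"
  interpret W: module R ?W using R(1) by (rule supp_module_module)
  interpret N: LinearCombinations.submodule R N ?W by (rule insert.prems)
  define N0 where "N0 = {u \<in> N. u t = \<zero>\<^bsub>R\<^esub>}"
  have N0: "LinearCombinations.submodule R N0 ?W"
  proof (rule LinearCombinations.submodule.intro)
    show "v \<oplus>\<^bsub>?W\<^esub> w \<in> N0" if "v \<in> N0" "w \<in> N0" for v w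
      using that N.m_closed[of v w] by (simp add: N0_def)
    show "c \<odot>\<^bsub>?W\<^esub> v \<in> N0" if "c \<in> carrier R" "v \<in> N0" for c v
      using that N.smult_closed[of c v] by (simp add: N0_def)
    show "\<zero>\<^bsub>?W\<^esub> \<in> N0" using N.zero_closed by (simp add: N0_def)
    show "N0 \<subseteq> carrier ?W" using N.subset by (auto simp: N0_def)
  qed (rule N.module)
  have "\<exists>A. finite A \<and> A \<subseteq> N0 \<and>
      (\<forall>N'. LinearCombinations.submodule R N' ?W \<longrightarrow> A \<subseteq> N' \<longrightarrow> N0 \<subseteq> N')"
  proof (rule insert.IH[OF N0])
    show "u s = \<zero>\<^bsub>R\<^esub>" if "u \<in> N0" "s \<notin> S" for u s
      using that insert.prems(2)[of u s] by (cases "s = t") (auto simp: N0_def)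
  qed
  then obtain A where A: "finite A" "A \<subseteq> N0"
    and A': "\<And>N'. LinearCombinations.submodule R N' ?W \<Longrightarrow> A \<subseteq> N' \<Longrightarrow> N0 \<subseteq> N'" by blast
  have "ideal ((\<lambda>u. u t) ` N) R" by (rule evaluation_ideal[OF insert.prems(1)])
  then obtain B where B: "B \<subseteq> carrier R" "finite B" "(\<lambda>u. u t) ` N = Idl\<^bsub>R\<^esub> B"
    using finetely_gen[of "(\<lambda>u. u t) ` N"] by auto
  have "B \<subseteq> (\<lambda>u. u t) ` N" unfolding B(3) using B(1) by (rule genideal_self)
  then obtain C where C: "C \<subseteq> N" "finite C" "B = (\<lambda>u. u t) ` C"
    using finite_subset_image[OF B(2)] by (metis (no_types, lifting))
  have "N \<subseteq> N'" if N': "LinearCombinations.submodule R N' ?W" "A \<union> C \<subseteq> N'" for N'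
  proof
    fix u assume u: "u \<in> N"
    interpret N': LinearCombinations.submodule R N' ?W by fact
    \<comment> \<open>Evaluating the intersection rather than \<open>N'\<close> yields a
      \<open>v\<close> in both submodules, so that \<open>u - v\<close> lies in \<open>N\<close> and
      vanishes at \<open>t\<close>.\<close>
    have "ideal ((\<lambda>u. u t) ` (N \<inter> N')) R"
      by (intro evaluation_ideal submodule_Int insert.prems(1) N'(1))
    moreover have "B \<subseteq> (\<lambda>u. u t) ` (N \<inter> N')" using C N'(2) by blast
    ultimately have "Idl\<^bsub>R\<^esub> B \<subseteq> (\<lambda>u. u t) ` (N \<inter> N')" by (rule genideal_minimal)
    then obtain v where v: "v \<in> N" "v \<in> N'" "u t = v t" using u B(3) by blast
    let ?d = "u \<oplus>\<^bsub>?W\<^esub> (\<ominus>\<^bsub>R\<^esub> \<one>\<^bsub>R\<^esub>) \<odot>\<^bsub>?W\<^esub> v"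
    have "u \<in> carrier ?W" "v \<in> carrier ?W" using N.subset u v(1) by blast+
    then have uv: "u s \<in> carrier R" "v s \<in> carrier R" for s by simp_all
    have d: "?d s = u s \<ominus>\<^bsub>R\<^esub> v s" for s
      using uv[of s] by (simp add: l_minus a_minus_def)
    have "(\<ominus>\<^bsub>R\<^esub> \<one>\<^bsub>R\<^esub>) \<odot>\<^bsub>?W\<^esub> v \<in> N" using v(1) by (rule N.smult_closed[rotated]) simp
    with u have "?d \<in> N" by (rule N.m_closed)
    moreover have "?d t = \<zero>\<^bsub>R\<^esub>" unfolding d v(3) using uv[of t] by (simp add: a_minus_def r_neg)
    ultimately have "?d \<in> N0" by (simp add: N0_def)
    then have "?d \<in> N'" using A'[OF N'(1)] N'(2) by blast
    then have "?d \<oplus>\<^bsub>?W\<^esub> v \<in> N'" using v(2) by (rule N'.m_closed)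
    moreover have "?d \<oplus>\<^bsub>?W\<^esub> v = u"
    proof
      fix s
      have "(?d \<oplus>\<^bsub>?W\<^esub> v) s = ?d s \<oplus>\<^bsub>R\<^esub> v s" by simp
      also have "\<dots> = u s" unfolding d using uv[of s] by (simp add: a_minus_def a_assoc l_neg)
      finally show "(?d \<oplus>\<^bsub>?W\<^esub> v) s = u s" .
    qed
    ultimately show "u \<in> N'" by simp
  qed
  moreover have "finite (A \<union> C)" "A \<union> C \<subseteq> N" using A C by (auto simp: N0_def)
  ultimately show ?case by (intro exI[of _ "A \<union> C"]) simp
qed

section \<open>Homology of the Koszul complex\<close>

definition koszul :: "('r, 'x) ring_scheme \<Rightarrow> 'r list \<Rightarrow> ('r, nat \<Rightarrow> 'r) cplx"
  where "koszul R xs =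
    \<lparr>ob = (\<lambda>i. supp_module R (koszul_index (length xs) i)), bd = (\<lambda>i. koszul_bd R xs)\<rparr>"

lemma koszul_simps [simp]:
  "ob (koszul R xs) i = supp_module R (koszul_index (length xs) i)"
  "bd (koszul R xs) i = koszul_bd R xs"
  by (simp_all add: koszul_def)

lemma koszul_complex:
  assumes "cring R" "set xs \<subseteq> carrier R"
  shows "is_complex R (koszul R xs)"
proof -
  interpret cring R by fact
  have "koszul_bd R xs \<in> module_hom R (supp_module R (koszul_index (length xs) i))
      (supp_module R (koszul_index (length xs) (i - 1)))" for i
  proof (rule module_homI)
    fix u assume u: "u \<in> carrier (supp_module R (koszul_index (length xs) i))"
    then show "koszul_bd R xs u \<in> carrier (supp_module R (koszul_index (length xs) (i - 1)))"
      using assms(2) by (auto intro: koszul_bd_closed koszul_bd_support)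
    have cl: "koszul_bd R xs u t \<in> carrier R" for t
      using u assms(2) by (auto intro: koszul_bd_closed)
    show "koszul_bd R xs (r \<odot>\<^bsub>supp_module R (koszul_index (length xs) i)\<^esub> u) =
        r \<odot>\<^bsub>supp_module R (koszul_index (length xs) (i - 1))\<^esub> koszul_bd R xs u" if "r \<in> carrier R" for r
      using koszul_bd_lin[OF assms(2), of "\<lambda>_. \<zero>\<^bsub>R\<^esub>" u r] u that cl
      by (auto simp: koszul_bd_zero[OF assms(2)])
    fix v assume v: "v \<in> carrier (supp_module R (koszul_index (length xs) i))"
    have cl': "koszul_bd R xs v t \<in> carrier R" for t
      using v assms(2) by (auto intro: koszul_bd_closed)
    show "koszul_bd R xs (u \<oplus>\<^bsub>supp_module R (koszul_index (length xs) i)\<^esub> v) =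
        koszul_bd R xs u \<oplus>\<^bsub>supp_module R (koszul_index (length xs) (i - 1))\<^esub> koszul_bd R xs v"
      using koszul_bd_lin[OF assms(2), of u v "\<one>\<^bsub>R\<^esub>"] u v cl' by auto
  qed
  then show ?thesis
    using assms by (auto simp: is_complex_def supp_module_module koszul_bd_bd)
qed

lemma koszul_homology_annihilated:
  assumes R: "cring R" "set xs \<subseteq> carrier R" and r: "r \<in> Idl\<^bsub>R\<^esub> (set xs)"
    and X: "X \<in> carrier (homology (koszul R xs) i)"
  shows "r \<odot>\<^bsub>homology (koszul R xs) i\<^esub> X = \<zero>\<^bsub>homology (koszul R xs) i\<^esub>"
proof -
  interpret cring R by fact
  interpret chain_complex R "koszul R xs"
    by unfold_locales (rule koszul_complex[OF R])
  let ?H = "homology (koszul R xs) i"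
  have H: "module R ?H" by (rule homology_module)
  \<comment> \<open>Being an ideal, the annihilator of the class \<open>X\<close> needs to contain
    the generators only.\<close>
  define I where "I = {r \<in> carrier R. r \<odot>\<^bsub>?H\<^esub> X = \<zero>\<^bsub>?H\<^esub>}"
  have "ideal I R" unfolding I_def using H X by (rule module.annihilator_ideal)
  moreover have "set xs \<subseteq> I"
  proof
    fix x assume "x \<in> set xs"
    then obtain j where j: "j < length xs" "x = xs ! j" by (metis in_set_conv_nth)
    have x: "x \<in> carrier R" using \<open>x \<in> set xs\<close> R(2) by blast
    let ?S = "koszul_index (length xs)"
    obtain z where z: "z \<in> cycles (koszul R xs) i"
        "X = boundaries (koszul R xs) i +>\<^bsub>(ob (koszul R xs) i)\<lparr>carrier := cycles (koszul R xs) i\<rparr>\<^esub> z"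
      using X unfolding homology_def H.coset_carrier by auto
    have zc: "\<And>t. z t \<in> carrier R" "\<And>t. t \<notin> ?S i \<Longrightarrow> z t = \<zero>\<^bsub>R\<^esub>" "koszul_bd R xs z = (\<lambda>_. \<zero>\<^bsub>R\<^esub>)"
      using z(1) by (auto simp: cycles_def)
    let ?h = "koszul_homotopy R xs j z"
    have h: "?h \<in> carrier (supp_module R (?S (i + 1)))"
      using zc by (auto intro: koszul_homotopy_closed koszul_homotopy_support)
    have "koszul_bd R xs ?h t = x \<otimes>\<^bsub>R\<^esub> z t" for t
    proof -
      \<comment> \<open>On a cycle the summand of the homotopy identity with the inner differential
        vanishes, so \<open>x z\<close> is the boundary of \<open>?h\<close>.\<close>
      have "koszul_bd R xs ?h t \<in> carrier R"
        using h R(2) by (intro koszul_bd_closed) auto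
      then show ?thesis
        using koszul_homotopy_bd[of xs z j t] R(2) zc(1) j by (simp add: zc(3) koszul_homotopy_zero)
    qed
    then have "koszul_bd R xs ?h = (\<lambda>t. x \<otimes>\<^bsub>R\<^esub> z t)" by (rule ext)
    then have "(\<lambda>t. x \<otimes>\<^bsub>R\<^esub> z t) \<in> boundaries (koszul R xs) i"
      using h unfolding boundaries_def by (auto intro: rev_image_eqI)
    moreover from this have "(\<lambda>t. x \<otimes>\<^bsub>R\<^esub> z t) \<in> cycles (koszul R xs) i"
      using boundaries_subset by blast
    ultimately have "x \<odot>\<^bsub>?H\<^esub> X = \<zero>\<^bsub>?H\<^esub>"
      using z H.coset_smult[OF x, of z i] H.coset_eq_zero_iff[of "\<lambda>t. x \<otimes>\<^bsub>R\<^esub> z t" i]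
      by (simp add: homology_def)
    then show "x \<in> I" using x by (simp add: I_def)
  qed
  ultimately have "Idl\<^bsub>R\<^esub> (set xs) \<subseteq> I" by (rule genideal_minimal)
  with r show ?thesis by (auto simp: I_def)
qed

text \<open>The cycles form a submodule of a free module of finite rank, so they have finitely many
  generators, and the classes of these generate the homology.\<close>

lemma koszul_homology_iso_power:
  assumes R: "cring R" "noetherian_ring R" and xs: "set xs \<subseteq> carrier R"
    and m: "maximalideal m R" "m = Idl\<^bsub>R\<^esub> (set xs)"
  shows "\<exists>a. module_iso R (homology (koszul R xs) i) (power_module (quot_module (ring_as_module R) m) a)"
proof -
  interpret chain_complex R "koszul R xs"
    by unfold_locales (rule koszul_complex[OF R(1) xs])
  let ?S = "koszul_index (length xs) i" and ?Z = "cycles (koszul R xs) i"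
  let ?M = "(ob (koszul R xs) i)\<lparr>carrier := ?Z\<rparr>" and ?B = "boundaries (koszul R xs) i"
  let ?W = "supp_module R UNIV"
  interpret ZS: LinearCombinations.submodule R ?Z "supp_module R ?S"
    using cycles_submodule[of i] by simp
  have "LinearCombinations.submodule R ?Z ?W"
    by (rule supp_module_mono) unfold_locales
  moreover have "u t = \<zero>\<^bsub>R\<^esub>" if "u \<in> ?Z" "t \<notin> ?S" for u t
    using ZS.subset that by auto
  ultimately obtain A where A: "finite A" "A \<subseteq> ?Z"
    and gen: "\<And>N'. LinearCombinations.submodule R N' ?W \<Longrightarrow> A \<subseteq> N' \<Longrightarrow> ?Z \<subseteq> N'"
    using noetherian_submodule_finitely_generated[OF R finite_koszul_index] by metis
  let ?q = "\<lambda>z. ?B +>\<^bsub>?M\<^esub> z"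
  show ?thesis
  proof (rule annihilated_iso_power[OF homology_module m(1)])
    show "r \<odot>\<^bsub>homology (koszul R xs) i\<^esub> X = \<zero>\<^bsub>homology (koszul R xs) i\<^esub>"
      if "r \<in> m" "X \<in> carrier (homology (koszul R xs) i)" for r X
      using R(1) xs that unfolding m(2) by (rule koszul_homology_annihilated)
    show "finite (?q ` A)" using A(1) by simp
    show "?q ` A \<subseteq> carrier (homology (koszul R xs) i)"
      using A(2) unfolding homology_def H.coset_carrier by auto
    fix N assume N: "LinearCombinations.submodule R N (homology (koszul R xs) i)" "?q ` A \<subseteq> N"
    interpret N: LinearCombinations.submodule R N "quot_module ?M ?B"
      using N(1) by (simp add: homology_def)
    \<comment> \<open>The preimage of \<open>N\<close> in the cycles: generation by \<open>A\<close>
      transfers to the quotient by pulling submodules back.\<close>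
    define N' where "N' = {z \<in> ?Z. ?q z \<in> N}"
    have "LinearCombinations.submodule R N' (supp_module R ?S)"
    proof (rule LinearCombinations.submodule.intro)
      show "N' \<subseteq> carrier (supp_module R ?S)" using ZS.subset by (auto simp: N'_def)
      show "\<zero>\<^bsub>supp_module R ?S\<^esub> \<in> N'"
        using ZS.zero_closed H.coset_zero[of i] N.zero_closed by (simp add: N'_def)
    next
      fix v w assume "v \<in> N'" "w \<in> N'"
      then have vw: "v \<in> ?Z" "w \<in> ?Z" "?q v \<in> N" "?q w \<in> N" by (auto simp: N'_def)
      have "v \<oplus>\<^bsub>supp_module R ?S\<^esub> w \<in> ?Z" using vw(1,2) by (rule ZS.m_closed)
      moreover have "?q (v \<oplus>\<^bsub>supp_module R ?S\<^esub> w) \<in> N"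
        using N.m_closed[OF vw(3,4)] H.coset_add[of v i w] vw(1,2) by simp
      ultimately show "v \<oplus>\<^bsub>supp_module R ?S\<^esub> w \<in> N'" by (simp add: N'_def)
    next
      fix c v assume c: "c \<in> carrier R" and "v \<in> N'"
      then have v: "v \<in> ?Z" "?q v \<in> N" by (auto simp: N'_def)
      have "c \<odot>\<^bsub>supp_module R ?S\<^esub> v \<in> ?Z" using c v(1) by (rule ZS.smult_closed)
      moreover have "?q (c \<odot>\<^bsub>supp_module R ?S\<^esub> v) \<in> N"
        using N.smult_closed[OF c v(2)] H.coset_smult[OF c, of v i] v(1) by simp
      ultimately show "c \<odot>\<^bsub>supp_module R ?S\<^esub> v \<in> N'" by (simp add: N'_def)
    qed (rule ZS.module)
    then have "LinearCombinations.submodule R N' ?W" by (rule supp_module_mono)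
    moreover have "A \<subseteq> N'" using A(2) N(2) by (auto simp: N'_def)
    ultimately have "?Z \<subseteq> N'" by (rule gen)
    then show "carrier (homology (koszul R xs) i) \<subseteq> N"
      unfolding homology_def H.coset_carrier by (auto simp: N'_def)
  qed
qed

lemma zero_mem_koszul_index: "0 \<in> koszul_index n 0"
  by (induction n) auto

lemma zero_supp_module_iff:
  assumes "cring R" "\<one>\<^bsub>R\<^esub> \<noteq> \<zero>\<^bsub>R\<^esub>"
  shows "zero_module (supp_module R S) \<longleftrightarrow> S = {}"
proof -
  interpret cring R by fact
  have "S = {}" if z: "zero_module (supp_module R S)"
  proof (rule equals0I)
    fix t assume "t \<in> S"
    then have e: "(\<lambda>s. if s = t then \<one>\<^bsub>R\<^esub> else \<zero>\<^bsub>R\<^esub>) \<in> carrier (supp_module R S)" by auto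
    have c: "carrier (supp_module R S) = {\<lambda>_. \<zero>\<^bsub>R\<^esub>}"
      using z by (simp add: zero_module_def)
    have "(\<lambda>s. if s = t then \<one>\<^bsub>R\<^esub> else \<zero>\<^bsub>R\<^esub>) = (\<lambda>_. \<zero>\<^bsub>R\<^esub>)"
      using e unfolding c by (rule singletonD)
    then show False using assms(2) by (metis (mono_tags))
  qed
  moreover have "carrier (supp_module R {}) = {\<zero>\<^bsub>supp_module R {}\<^esub>}"
    by (auto simp: supp_module_def)
  ultimately show ?thesis by (auto simp: zero_module_def)
qed

text \<open>The exact values of \<open>csup\<close> and \<open>cinf\<close> give the length;
  together with \<open>0 <= hsup\<close> they bound the dimension.\<close>

lemma koszul_quasi_projective_resolution:
  assumes R: "cring R" "noetherian_ring R" and xs: "set xs \<subseteq> carrier R"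
    and m: "maximalideal m R" "m = Idl\<^bsub>R\<^esub> (set xs)"
  shows "finite_quasi_projective_resolution R (quot_module (ring_as_module R) m) (koszul R xs)"
    and "csup (koszul R xs) = ereal (real (length xs))" and "cinf (koszul R xs) = 0"
    and "0 \<le> hsup (koszul R xs)"
proof -
  interpret cring R by fact
  interpret m: maximalideal m R by fact
  let ?K = "koszul R xs"
  interpret K: chain_complex R ?K
    by unfold_locales (rule koszul_complex[OF R(1) xs])
  have one: "\<one>\<^bsub>R\<^esub> \<notin> m" using m.one_imp_carrier m.I_notcarr by blast
  then have "\<one>\<^bsub>R\<^esub> \<noteq> \<zero>\<^bsub>R\<^esub>" using m.zero_closed by metis
  then have ob: "\<not> zero_module (ob ?K i) \<longleftrightarrow> 0 \<le> i \<and> i \<le> int (length xs)" for i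
    using koszul_index_nonempty_iff[of "length xs" i] by (simp add: zero_supp_module_iff[OF R(1)])
  show sup: "csup ?K = ereal (real (length xs))"
    unfolding csup_def ob
  proof (rule Sup_eqI)
    show "y \<le> ereal (real (length xs))"
      if "y \<in> {ereal (real_of_int i) |i. 0 \<le> i \<and> i \<le> int (length xs)}" for y
      using that by auto
    show "ereal (real (length xs)) \<le> y"
      if "\<And>z. z \<in> {ereal (real_of_int i) |i. 0 \<le> i \<and> i \<le> int (length xs)} \<Longrightarrow> z \<le> y" for y
      by (rule that) (auto intro!: exI[of _ "int (length xs)"])
  qed
  show inf: "cinf ?K = 0"
    unfolding cinf_def ob
  proof (rule Inf_eqI)
    show "0 \<le> y" if "y \<in> {ereal (real_of_int i) |i. 0 \<le> i \<and> i \<le> int (length xs)}" for y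
      using that by auto
    show "y \<le> 0"
      if "\<And>z. z \<in> {ereal (real_of_int i) |i. 0 \<le> i \<and> i \<le> int (length xs)} \<Longrightarrow> y \<le> z" for y
      by (rule that) (auto intro!: exI[of _ "0 :: int"])
  qed
  \<comment> \<open>The unit chain at index 0 is a cycle, as there are no indices of degree -1. It
    is no boundary, since a boundary has its entry at 0 in \<open>m\<close> and 1 is not in
    \<open>m\<close>.\<close>
  have H0: "\<not> zero_module (homology ?K 0)"
  proof
    assume "zero_module (homology ?K 0)"
    then have cb: "cycles ?K 0 = boundaries ?K 0" by (simp add: K.zero_homology_iff)
    define e where "e = (\<lambda>t::nat. if t = 0 then \<one>\<^bsub>R\<^esub> else \<zero>\<^bsub>R\<^esub>)"
    have e: "e \<in> carrier (ob ?K 0)"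
      using zero_mem_koszul_index by (auto simp: e_def)
    have "bd ?K 0 e \<in> carrier (ob ?K (0 - 1))"
      by (rule module_hom_closedD[OF K.bd_hom e])
    moreover have "koszul_index (length xs) (0 - 1) = {}"
      using koszul_index_nonempty_iff[of "length xs" "0 - 1"] by auto
    ultimately have "e \<in> cycles ?K 0" using e by (auto simp: cycles_def)
    then obtain u where u: "u \<in> carrier (ob ?K 1)" "e = koszul_bd R xs u"
      unfolding cb by (auto simp: boundaries_def)
    have "set xs \<subseteq> m" unfolding m(2) using xs by (rule genideal_self)
    then have "koszul_bd R xs u 0 \<in> m"
      using u(1) by (intro koszul_bd_0_mem m.is_ideal) auto
    then show False using one u(2) by (metis (full_types) e_def)
  qed
  show "0 \<le> hsup ?K"
    unfolding hsup_def by (rule Sup_upper) (use H0 in \<open>auto intro!: exI[of _ "0 :: int"]\<close>)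
  let ?k = "quot_module (ring_as_module R) m"
  have k: "module R ?k"
    using residue_module_quotient[OF R(1) m.is_ideal] by (rule module_quotient.quot_module_module)
  obtain a where a: "\<And>i. module_iso R (homology ?K i) (power_module ?k (a i))"
    using koszul_homology_iso_power[OF R xs m] by metis
  \<comment> \<open>The required nonzero multiplicity is found in degree 0, where the homology
    survives.\<close>
  have "a 0 \<noteq> 0"
  proof
    assume "a 0 = 0"
    then have "module_iso R (homology ?K 0) (power_module ?k 0)" using a[of 0] by simp
    then show False
      using H0 zero_module_iso[OF K.homology_module power_module_module[OF k]] zero_power_module by blast
  qed
  moreover have "projective_module R (ob ?K i)" for i
    using supp_module_projective[OF R(1) finite_koszul_index] by simp
  moreover have "bounded_below ?K" "bounded_above ?K"
    unfolding bounded_below_def bounded_above_def using ob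
    by (metis not_le, metis not_le)
  ultimately show "finite_quasi_projective_resolution R ?k ?K"
    unfolding finite_quasi_projective_resolution_def quasi_projective_resolution_def
    using a K.cplx inf by (auto intro!: exI[of _ a] exI[of _ "0 :: int"])
qed

section \<open>Embedding dimension of a local ring\<close>

text \<open>In Zorn's lemma the union of a nonempty chain of ideals is itself a member of the chain,
  by noetherianity, so it is proper at once.\<close>

lemma (in noetherian_ring) maximalideal_exists:
  assumes I: "ideal I R" "I \<noteq> carrier R"
  shows "\<exists>m. maximalideal m R \<and> I \<subseteq> m"
proof -
  define A where "A = {J. ideal J R \<and> I \<subseteq> J \<and> J \<noteq> carrier R}"
  have "\<exists>M\<in>A. \<forall>X\<in>A. M \<subseteq> X \<longrightarrow> X = M"
  proof (rule subset_Zorn_nonempty)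
    show "A \<noteq> {}" using I unfolding A_def by blast
    fix C assume C: "C \<noteq> {}" "subset.chain A C"
    then have "subset.chain {I. ideal I R} C" unfolding subset.chain_def A_def by blast
    with C(1) have "\<Union>C \<in> C" by (rule ideal_chain_is_trivial)
    then show "\<Union>C \<in> A" using C(2) unfolding subset.chain_def by blast
  qed
  then obtain M where M: "M \<in> A" "\<And>X. X \<in> A \<Longrightarrow> M \<subseteq> X \<Longrightarrow> X = M" by blast
  have M': "ideal M R" "I \<subseteq> M" "M \<noteq> carrier R" using M(1) unfolding A_def by blast+
  have "maximalideal M R"
  proof (rule maximalidealI)
    fix J assume J: "ideal J R" "M \<subseteq> J"
    show "J = M \<or> J = carrier R"
    proof (cases "J = carrier R")
      case False
      then have "J \<in> A" using J M'(2) unfolding A_def by blast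
      then show ?thesis using M(2) J(2) by blast
    qed simp
  qed (use M' in simp_all)
  then show ?thesis using M'(2) by blast
qed

locale noetherian_local = cring R + noetherian_ring R for R (structure) +
  assumes local: "local_ring R"
begin

abbreviation "\<mm> \<equiv> max_ideal R"

lemma maximalideal_max_ideal: "maximalideal \<mm> R"
  unfolding max_ideal_def by (rule theI') (use local in \<open>simp add: local_ring_def\<close>)

lemma maximalideal_unique: "maximalideal I R \<Longrightarrow> I = \<mm>"
  using local maximalideal_max_ideal unfolding local_ring_def by blast

sublocale m: maximalideal \<mm> R by (rule maximalideal_max_ideal)

text \<open>A proper principal ideal generated by \<open>1 - c\<close> would lie in the only maximal
  ideal, and then so would 1.\<close>

lemma one_minus_max_ideal_inverse:
  assumes c: "c \<in> \<mm>"
  shows "\<exists>s\<in>carrier R. s \<otimes> (\<one> \<ominus> c) = \<one>"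
proof -
  have cR: "c \<in> carrier R" using c by (rule m.Icarr)
  let ?u = "\<one> \<ominus> c"
  have u: "?u \<in> carrier R" using cR by simp
  have I: "ideal (PIdl ?u) R" using u by (rule cgenideal_ideal)
  have "PIdl ?u = carrier R"
  proof (rule ccontr)
    assume "PIdl ?u \<noteq> carrier R"
    then have "PIdl ?u \<subseteq> \<mm>" using maximalideal_exists[OF I] maximalideal_unique by blast
    then have "?u \<in> \<mm>" using cgenideal_self[OF u] by blast
    then have "?u \<oplus> c \<in> \<mm>" using c by (rule m.a_closed)
    moreover have "?u \<oplus> c = \<one>" using cR by (simp add: a_minus_def a_assoc l_neg)
    ultimately show False using m.one_imp_carrier m.I_notcarr by simp
  qed
  then have "\<one> \<in> PIdl ?u" by simp
  then obtain s where "s \<in> carrier R" "\<one> = s \<otimes> ?u" unfolding cgenideal_def by blast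
  then show ?thesis by (intro bexI[of _ s]) simp_all
qed

text \<open>
  Nakayama's lemma, removing the generators of \<open>\<mm>\<close> one at a time: \<open>g \<in> J + \<mm> \<cdot> \<mm>\<close> gives
  \<open>(1 - c) g \<in> J'\<close> with \<open>c \<in> \<mm>\<close>, where \<open>J'\<close> is generated by \<open>J\<close> and the remaining generators.
\<close>

lemma nakayama_max_ideal:
  assumes J: "ideal J R" "J \<subseteq> \<mm>"
    and gen: "\<And>z. z \<in> \<mm> \<Longrightarrow> \<exists>x\<in>J. z \<ominus> x \<in> \<mm> \<cdot> \<mm>"
    and gs: "set gs \<subseteq> \<mm>" "\<mm> \<subseteq> Idl (J \<union> set gs)"
  shows "\<mm> = J"
  using gs
proof (induction gs)
  case Nil
  have "Idl (J \<union> set []) \<subseteq> J" using J(1) by (intro genideal_minimal) simp_all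
  then show ?case using Nil.prems(2) J(2) by blast
next
  case (Cons g gs)
  have mR: "\<mm> \<subseteq> carrier R" by (rule m.a_subset)
  have g: "g \<in> \<mm>" "g \<in> carrier R" using Cons.prems(1) mR by auto
  let ?S = "J \<union> set gs"
  have SR: "?S \<subseteq> carrier R" using J(2) Cons.prems(1) mR by auto
  define J' where "J' = Idl ?S"
  have J': "ideal J' R" unfolding J'_def using SR by (rule genideal_ideal)
  have SJ': "?S \<subseteq> J'" unfolding J'_def using SR by (rule genideal_self)
  interpret J': ideal J' R by (rule J')
  let ?T = "J' <+>\<^bsub>R\<^esub> PIdl g"
  have T: "ideal ?T R" using J' cgenideal_ideal[OF g(2)] by (rule add_ideals)
  have mem: "?T = {j \<oplus> r \<otimes> g | j r. j \<in> J' \<and> r \<in> carrier R}"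
    by (auto simp: set_add_def' cgenideal_def)
  have "J \<union> set (g # gs) \<subseteq> ?T"
  proof
    fix y assume "y \<in> J \<union> set (g # gs)"
    then consider "y = g" | "y \<in> J'" using SJ' by auto
    then show "y \<in> ?T"
    proof cases
      case 1
      then have "y = \<zero> \<oplus> \<one> \<otimes> g" using g by simp
      then show ?thesis unfolding mem using J'.zero_closed one_closed by blast
    next
      case 2
      then have "y = y \<oplus> \<zero> \<otimes> g" using g by simp
      then show ?thesis unfolding mem using 2 zero_closed by blast
    qed
  qed
  then have "Idl (J \<union> set (g # gs)) \<subseteq> ?T" by (rule genideal_minimal[OF T])
  then have mT: "\<mm> \<subseteq> ?T" using Cons.prems(2) by blast
  \<comment> \<open>In a product of two elements of the maximal ideal the second factor is written
    as \<open>j + r g\<close> by \<open>mT\<close>; the first factor \<open>a\<close> then gives the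
    coefficient \<open>a r\<close>, which is again in the maximal ideal.\<close>
  have prod: "\<exists>j\<in>J'. \<exists>c\<in>\<mm>. y = j \<oplus> c \<otimes> g" if "y \<in> \<mm> \<cdot> \<mm>" for y
    using that
  proof (induction rule: ideal_prod.induct)
    case (prod a b)
    obtain j r where b: "b = j \<oplus> r \<otimes> g" "j \<in> J'" "r \<in> carrier R"
      using mT prod(2) unfolding mem by blast
    have cl: "a \<in> carrier R" "j \<in> carrier R" using prod(1) b(2) m.Icarr J'.Icarr by auto
    have "a \<otimes> b = a \<otimes> j \<oplus> (a \<otimes> r) \<otimes> g" using cl b g by (simp add: r_distr m_assoc)
    then show ?case using J'.I_l_closed[OF b(2) cl(1)] m.I_r_closed[OF prod(1) b(3)] by blast
  next
    case (sum y z)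
    then obtain j c j' c' where *: "j \<in> J'" "c \<in> \<mm>" "y = j \<oplus> c \<otimes> g" "j' \<in> J'" "c' \<in> \<mm>" "z = j' \<oplus> c' \<otimes> g"
      by blast
    then have "j \<in> carrier R" "c \<in> carrier R" "j' \<in> carrier R" "c' \<in> carrier R"
      using m.Icarr J'.Icarr by auto
    then have "y \<oplus> z = (j \<oplus> j') \<oplus> (c \<oplus> c') \<otimes> g"
      using g(2) unfolding *(3,6) by algebra
    then show ?case using J'.a_closed[OF *(1,4)] m.a_closed[OF *(2,5)] by blast
  qed
  obtain x where x: "x \<in> J" "g \<ominus> x \<in> \<mm> \<cdot> \<mm>" using gen[OF g(1)] by blast
  obtain j c where jc: "j \<in> J'" "c \<in> \<mm>" "g \<ominus> x = j \<oplus> c \<otimes> g" using prod[OF x(2)] by blast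
  have xJ': "x \<in> J'" using x(1) SJ' by blast
  have cl: "x \<in> carrier R" "j \<in> carrier R" "c \<in> carrier R"
    using xJ' jc m.Icarr J'.Icarr by auto
  have "(\<one> \<ominus> c) \<otimes> g = (g \<ominus> x) \<oplus> x \<ominus> c \<otimes> g" using cl g(2) by algebra
  also have "\<dots> = j \<oplus> x" unfolding jc(3) using cl g(2) by algebra
  finally have ug: "(\<one> \<ominus> c) \<otimes> g = j \<oplus> x" .
  obtain s where s: "s \<in> carrier R" "s \<otimes> (\<one> \<ominus> c) = \<one>"
    using one_minus_max_ideal_inverse[OF jc(2)] by blast
  have "g = s \<otimes> ((\<one> \<ominus> c) \<otimes> g)"
    using s cl g(2) by (simp flip: m_assoc)
  also have "\<dots> \<in> J'"
    unfolding ug using J'.a_closed[OF jc(1) xJ'] s(1) by (rule J'.I_l_closed)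
  finally have "g \<in> J'" .
  then have "J \<union> set (g # gs) \<subseteq> J'" using SJ' by auto
  then have "Idl (J \<union> set (g # gs)) \<subseteq> J'" by (rule genideal_minimal[OF J'])
  then have "\<mm> \<subseteq> Idl (J \<union> set gs)" using Cons.prems(2) by (simp add: J'_def)
  then show ?case using Cons.IH Cons.prems(1) by simp
qed

section \<open>The cotangent space and its dimension\<close>

abbreviation "\<mm>2 \<equiv> \<mm> \<cdot> \<mm>"

lemma square_ideal: "ideal \<mm>2 R"
  by (intro ideal_prod_is_ideal m.is_ideal)

sublocale m2: ideal \<mm>2 R by (rule square_ideal)

lemma cotangent_space_simps:
  "carrier (cotangent_space R) = (\<lambda>x. \<mm>2 +> x) ` \<mm>"
  "\<zero>\<^bsub>cotangent_space R\<^esub> = \<mm>2"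
  "add (cotangent_space R) = set_add R"
  "smult (cotangent_space R) = rcoset_mult R \<mm>2"
  by (auto simp: cotangent_space_def Let_def A_RCOSETS_def RCOSETS_def a_r_coset_def r_coset_def)

text \<open>Neither representative matters: changing \<open>r\<close> by \<open>h\<close> and
  \<open>x\<close> by \<open>k\<close> changes the product by \<open>h k + h x + r k\<close>. The
  terms with \<open>k\<close> stay in the square, and \<open>h x\<close> is a product of two
  elements of the maximal ideal.\<close>

lemma cotangent_smult:
  assumes r: "r \<in> carrier R" and x: "x \<in> \<mm>"
  shows "(\<mm> +> r) \<odot>\<^bsub>cotangent_space R\<^esub> (\<mm>2 +> x) = \<mm>2 +> (r \<otimes> x)"
proof -
  have xR: "x \<in> carrier R" using x by (rule m.Icarr)
  have "\<mm>2 +> (a \<otimes> b) = \<mm>2 +> (r \<otimes> x)" if a: "a \<in> \<mm> +> r" and b: "b \<in> \<mm>2 +> x" for a b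
  proof -
    obtain h where h: "h \<in> \<mm>" "a = h \<oplus> r" using a by (auto simp: a_r_coset_def')
    obtain k where k: "k \<in> \<mm>2" "b = k \<oplus> x" using b by (auto simp: a_r_coset_def')
    have cl: "h \<in> carrier R" "k \<in> carrier R" using h k m.Icarr m2.Icarr by auto
    have "a \<otimes> b \<ominus> r \<otimes> x = h \<otimes> k \<oplus> h \<otimes> x \<oplus> r \<otimes> k"
      unfolding h(2) k(2) using cl r xR by algebra
    also have "\<dots> \<in> \<mm>2"
      using m2.I_l_closed[OF k(1) cl(1)] m2.I_l_closed[OF k(1) r] ideal_prod.prod[OF h(1) x]
      by (intro m2.a_closed)
    finally show ?thesis
      using quotient_eq_iff_same_a_r_cos[OF square_ideal, of "a \<otimes> b" "r \<otimes> x"] h(2) k(2) cl r xR by simp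
  qed
  then have "(\<Union>a\<in>\<mm> +> r. \<Union>b\<in>\<mm>2 +> x. \<mm>2 +> (a \<otimes> b)) = (\<Union>a\<in>\<mm> +> r. \<Union>b\<in>\<mm>2 +> x. \<mm>2 +> (r \<otimes> x))"
    by (intro SUP_cong refl)
  also have "\<dots> = \<mm>2 +> (r \<otimes> x)"
    using m.a_rcos_self[OF r] m2.a_rcos_self[OF xR] by blast
  finally show ?thesis unfolding cotangent_space_simps rcoset_mult_def .
qed

lemma cotangent_add:
  "x \<in> \<mm> \<Longrightarrow> y \<in> \<mm> \<Longrightarrow> (\<mm>2 +> x) \<oplus>\<^bsub>cotangent_space R\<^esub> (\<mm>2 +> y) = \<mm>2 +> (x \<oplus> y)"
  by (simp add: cotangent_space_simps m2.a_rcos_sum m.Icarr)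

text \<open>Writes zero as a coset of an element, the form to which \<open>cotangent_add\<close>
  applies.\<close>

lemma cotangent_zero: "\<zero>\<^bsub>cotangent_space R\<^esub> = \<mm>2 +> \<zero>"
  using m2.a_subset by (simp add: cotangent_space_simps)

lemma residue_carrier: "carrier (R Quot \<mm>) = (\<lambda>r. \<mm> +> r) ` carrier R"
  by (auto simp: FactRing_simps)

lemma cotangent_module: "module (R Quot \<mm>) (cotangent_space R)"
proof (intro moduleI abelian_groupI)
  let ?k = "R Quot \<mm>" and ?V = "cotangent_space R"
  have V: "\<exists>u\<in>\<mm>. x = \<mm>2 +> u" if "x \<in> carrier ?V" for x
    using that by (auto simp: cotangent_space_simps)
  have k: "\<exists>r\<in>carrier R. a = \<mm> +> r" if "a \<in> carrier ?k" for a
    using that by (auto simp: residue_carrier)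
  have cl: "\<mm>2 +> u \<in> carrier ?V" if "u \<in> \<mm>" for u
    using that by (simp add: cotangent_space_simps)
  have kadd: "(\<mm> +> r) \<oplus>\<^bsub>?k\<^esub> (\<mm> +> s) = \<mm> +> (r \<oplus> s)"
    and kmult: "(\<mm> +> r) \<otimes>\<^bsub>?k\<^esub> (\<mm> +> s) = \<mm> +> (r \<otimes> s)" if "r \<in> carrier R" "s \<in> carrier R" for r s
    using that by (simp_all add: FactRing_def m.a_rcos_sum m.rcoset_mult_add)
  show "cring ?k" using m.quotient_is_field[OF is_cring] by (simp add: field_def domain_def)
  show "\<zero>\<^bsub>?V\<^esub> \<in> carrier ?V" unfolding cotangent_zero by (intro cl m.zero_closed)
  fix x assume "x \<in> carrier ?V"
  then obtain u where u: "u \<in> \<mm>" "x = \<mm>2 +> u" using V by blast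
  have uR: "u \<in> carrier R" using u(1) by (rule m.Icarr)
  show "\<zero>\<^bsub>?V\<^esub> \<oplus>\<^bsub>?V\<^esub> x = x"
    unfolding cotangent_zero u(2) using u(1) uR by (subst cotangent_add) simp_all
  have "(\<mm>2 +> (\<ominus> u)) \<oplus>\<^bsub>?V\<^esub> x = \<zero>\<^bsub>?V\<^esub>"
    unfolding cotangent_zero u(2) using u(1) uR by (subst cotangent_add) (simp_all add: l_neg)
  then show "\<exists>y\<in>carrier ?V. y \<oplus>\<^bsub>?V\<^esub> x = \<zero>\<^bsub>?V\<^esub>"
    using cl[of "\<ominus> u"] u(1) by blast
  show "\<one>\<^bsub>?k\<^esub> \<odot>\<^bsub>?V\<^esub> x = x"
    using u uR cotangent_smult[OF one_closed u(1)] by (simp add: FactRing_def)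
  {
    fix y assume "y \<in> carrier ?V"
    then obtain v where v: "v \<in> \<mm>" "y = \<mm>2 +> v" using V by blast
    have vR: "v \<in> carrier R" using v(1) by (rule m.Icarr)
    show "x \<oplus>\<^bsub>?V\<^esub> y \<in> carrier ?V"
      unfolding u(2) v(2) cotangent_add[OF u(1) v(1)] by (intro cl m.a_closed u v)
    show "x \<oplus>\<^bsub>?V\<^esub> y = y \<oplus>\<^bsub>?V\<^esub> x"
      unfolding u(2) v(2) cotangent_add[OF u(1) v(1)] cotangent_add[OF v(1) u(1)]
      using a_comm[OF uR vR] by simp
    fix z assume "z \<in> carrier ?V"
    then obtain w where w: "w \<in> \<mm>" "z = \<mm>2 +> w" using V by blast
    have wR: "w \<in> carrier R" using w(1) by (rule m.Icarr)
    show "x \<oplus>\<^bsub>?V\<^esub> y \<oplus>\<^bsub>?V\<^esub> z = x \<oplus>\<^bsub>?V\<^esub> (y \<oplus>\<^bsub>?V\<^esub> z)"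
      unfolding u(2) v(2) w(2) using u(1) v(1) w(1) by (simp add: cotangent_add a_assoc uR vR wR)
  }
  fix a assume "a \<in> carrier ?k"
  then obtain r where r: "r \<in> carrier R" "a = \<mm> +> r" using k by blast
  have ru: "r \<otimes> u \<in> \<mm>" using u(1) r(1) by (rule m.I_l_closed)
  show "a \<odot>\<^bsub>?V\<^esub> x \<in> carrier ?V"
    unfolding r(2) u(2) cotangent_smult[OF r(1) u(1)] using ru by (rule cl)
  {
    fix y assume "y \<in> carrier ?V"
    then obtain v where v: "v \<in> \<mm>" "y = \<mm>2 +> v" using V by blast
    have vR: "v \<in> carrier R" using v(1) by (rule m.Icarr)
    have rv: "r \<otimes> v \<in> \<mm>" using v(1) r(1) by (rule m.I_l_closed)
    show "a \<odot>\<^bsub>?V\<^esub> (x \<oplus>\<^bsub>?V\<^esub> y) = a \<odot>\<^bsub>?V\<^esub> x \<oplus>\<^bsub>?V\<^esub> a \<odot>\<^bsub>?V\<^esub> y"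
      unfolding u(2) v(2) r(2) cotangent_add[OF u(1) v(1)] cotangent_smult[OF r(1) u(1)]
        cotangent_smult[OF r(1) v(1)] cotangent_add[OF ru rv]
        cotangent_smult[OF r(1) m.a_closed[OF u(1) v(1)]]
      by (simp add: r_distr uR vR r(1))
  }
  fix b assume "b \<in> carrier ?k"
  then obtain s where s: "s \<in> carrier R" "b = \<mm> +> s" using k by blast
  have su: "s \<otimes> u \<in> \<mm>" using u(1) s(1) by (rule m.I_l_closed)
  show "(a \<oplus>\<^bsub>?k\<^esub> b) \<odot>\<^bsub>?V\<^esub> x = a \<odot>\<^bsub>?V\<^esub> x \<oplus>\<^bsub>?V\<^esub> b \<odot>\<^bsub>?V\<^esub> x"
    unfolding u(2) r(2) s(2) kadd[OF r(1) s(1)] cotangent_smult[OF r(1) u(1)]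
      cotangent_smult[OF s(1) u(1)] cotangent_add[OF ru su]
      cotangent_smult[OF a_closed[OF r(1) s(1)] u(1)]
    by (simp add: l_distr uR r(1) s(1))
  show "(a \<otimes>\<^bsub>?k\<^esub> b) \<odot>\<^bsub>?V\<^esub> x = a \<odot>\<^bsub>?V\<^esub> (b \<odot>\<^bsub>?V\<^esub> x)"
    unfolding u(2) r(2) s(2) kmult[OF r(1) s(1)] cotangent_smult[OF s(1) u(1)]
      cotangent_smult[OF r(1) su] cotangent_smult[OF m_closed[OF r(1) s(1)] u(1)]
    by (simp add: m_assoc uR r(1) s(1))
qed

lemma cotangent_vectorspace: "vectorspace (R Quot \<mm>) (cotangent_space R)"
  using cotangent_module m.quotient_is_field[OF is_cring] by (rule vectorspace.intro)

text \<open>The elements whose class lies in the span of the classes of \<open>B\<close> form an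
  ideal \<open>J\<close> of \<open>R\<close>. It contains the generators \<open>B\<close>, hence the
  whole maximal ideal.\<close>

lemma cotangent_fin_dim: "vectorspace.fin_dim (R Quot \<mm>) (cotangent_space R)"
proof -
  let ?V = "cotangent_space R"
  interpret V: vectorspace "R Quot \<mm>" ?V by (rule cotangent_vectorspace)
  obtain B where B: "B \<subseteq> carrier R" "finite B" "\<mm> = Idl B"
    using finetely_gen[OF m.is_ideal] by auto
  have Bm: "B \<subseteq> \<mm>" unfolding B(3) using B(1) by (rule genideal_self)
  let ?A = "(\<lambda>x. \<mm>2 +> x) ` B"
  have A: "?A \<subseteq> carrier ?V" using Bm by (auto simp: cotangent_space_simps)
  interpret S: LinearCombinations.submodule "R Quot \<mm>" "V.span ?A" ?V
    using A by (rule V.span_is_submodule)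
  define J where "J = {x \<in> \<mm>. \<mm>2 +> x \<in> V.span ?A}"
  have sm: "r \<otimes> x \<in> J" if "x \<in> J" "r \<in> carrier R" for r x
  proof -
    have "\<mm> +> r \<in> carrier (R Quot \<mm>)" using that(2) by (simp add: residue_carrier)
    then have "(\<mm> +> r) \<odot>\<^bsub>?V\<^esub> (\<mm>2 +> x) \<in> V.span ?A"
      using that(1) by (intro S.smult_closed) (simp_all add: J_def)
    then show ?thesis using that by (simp add: J_def cotangent_smult m.I_l_closed)
  qed
  have "ideal J R"
  proof (rule idealI[OF ring_axioms])
    show "subgroup J (add_monoid R)"
    proof (rule add.subgroupI)
      show "J \<subseteq> carrier R" using m.a_subset by (auto simp: J_def)
      have "\<zero> \<in> J" using S.zero_closed by (simp add: J_def cotangent_zero)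
      then show "J \<noteq> {}" by blast
      show "\<ominus> x \<in> J" if "x \<in> J" for x
        using sm[OF that, of "\<ominus> \<one>"] that m.Icarr[of x] by (simp add: J_def l_minus)
      show "x \<oplus> y \<in> J" if "x \<in> J" "y \<in> J" for x y
      proof -
        have "x \<in> \<mm>" "y \<in> \<mm>" using that by (auto simp: J_def)
        moreover have "(\<mm>2 +> x) \<oplus>\<^bsub>?V\<^esub> (\<mm>2 +> y) \<in> V.span ?A"
          using that by (intro S.m_closed) (auto simp: J_def)
        ultimately show ?thesis by (simp add: J_def cotangent_add)
      qed
    qed
    show "r \<otimes> x \<in> J" if "x \<in> J" "r \<in> carrier R" for r x using that by (rule sm)
    show "x \<otimes> r \<in> J" if "x \<in> J" "r \<in> carrier R" for r x
      using sm[OF that] m_comm[of x r] that m.Icarr[of x] by (simp add: J_def)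
  qed
  moreover have "B \<subseteq> J" using Bm V.in_own_span[OF A] by (auto simp: J_def)
  ultimately have "\<mm> \<subseteq> J" unfolding B(3) by (rule genideal_minimal)
  then have "V.span ?A = carrier ?V"
    using V.span_is_subset2[OF A] by (auto simp: J_def cotangent_space_simps)
  then show ?thesis unfolding V.fin_dim_def using A B(2) by blast
qed

lemma max_ideal_generators:
  "\<exists>xs. set xs \<subseteq> carrier R \<and> \<mm> = Idl (set xs) \<and>
    length xs = vectorspace.dim (R Quot \<mm>) (cotangent_space R)"
proof -
  let ?V = "cotangent_space R"
  interpret V: vectorspace "R Quot \<mm>" ?V by (rule cotangent_vectorspace)
  \<comment> \<open>\<open>V.dim\<close> is by definition the least size of a finite generating set,
    so a generating set of this size exists as soon as some finite one does.\<close>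
  have "\<exists>n A. finite A \<and> card A = n \<and> A \<subseteq> carrier ?V \<and> V.gen_set A"
    using cotangent_fin_dim unfolding V.fin_dim_def by blast
  then have "\<exists>A. finite A \<and> card A = V.dim \<and> A \<subseteq> carrier ?V \<and> V.gen_set A"
    unfolding V.dim_def by (rule LeastI_ex)
  then obtain A where A: "finite A" "card A = V.dim" "A \<subseteq> carrier ?V" "V.span A = carrier ?V" by blast
  \<comment> \<open>One representative is chosen for each class, so the number of elements does not
    grow.\<close>
  obtain B where B: "B \<subseteq> \<mm>" "inj_on (\<lambda>x. \<mm>2 +> x) B" "A = (\<lambda>x. \<mm>2 +> x) ` B"
    using A(3) unfolding cotangent_space_simps by (auto simp: subset_image_inj)
  have fB: "finite B" "card B = V.dim"
    using A(1,2) B(2,3) by (auto simp: card_image dest: finite_imageD)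
  obtain xs where xs: "set xs = B" "length xs = V.dim"
    using finite_distinct_list[OF fB(1)] fB(2) distinct_card by metis
  have BR: "B \<subseteq> carrier R" using B(1) m.a_subset by blast
  let ?J = "Idl B"
  interpret J: ideal ?J R using BR by (rule genideal_ideal)
  have BJ: "B \<subseteq> ?J" using BR by (rule genideal_self)
  have Jm: "?J \<subseteq> \<mm>" using m.is_ideal B(1) by (rule genideal_minimal)
  \<comment> \<open>The image of \<open>?J\<close> is a subspace containing the generating set
    \<open>A\<close>, hence everything; so the maximal ideal is the sum of \<open>?J\<close> and its
    square, the hypothesis of Nakayama's lemma.\<close>
  define N where "N = (\<lambda>x. \<mm>2 +> x) ` ?J"
  have "LinearCombinations.submodule (R Quot \<mm>) N ?V"
  proof (rule LinearCombinations.submodule.intro)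
    show "N \<subseteq> carrier ?V" using Jm by (auto simp: N_def cotangent_space_simps)
    show "\<zero>\<^bsub>?V\<^esub> \<in> N" unfolding N_def cotangent_zero by (intro imageI J.zero_closed)
  next
    fix v w assume "v \<in> N" "w \<in> N"
    then obtain x y where "x \<in> ?J" "v = \<mm>2 +> x" "y \<in> ?J" "w = \<mm>2 +> y" by (auto simp: N_def)
    moreover from this have "x \<in> \<mm>" "y \<in> \<mm>" using Jm by auto
    ultimately show "v \<oplus>\<^bsub>?V\<^esub> w \<in> N" by (simp add: cotangent_add N_def)
  next
    fix c v assume "c \<in> carrier (R Quot \<mm>)" "v \<in> N"
    then obtain r x where "r \<in> carrier R" "c = \<mm> +> r" "x \<in> ?J" "v = \<mm>2 +> x"
      by (auto simp: N_def residue_carrier)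
    moreover from this have "x \<in> \<mm>" using Jm by auto
    ultimately show "c \<odot>\<^bsub>?V\<^esub> v \<in> N" by (simp add: cotangent_smult N_def J.I_l_closed)
  qed (rule cotangent_module)
  moreover have "A \<subseteq> N" unfolding B(3) N_def using BJ by blast
  ultimately have "carrier ?V \<subseteq> N" using V.span_is_subset A(4) by blast
  then have gen: "\<exists>x\<in>?J. z \<ominus> x \<in> \<mm>2" if z: "z \<in> \<mm>" for z
  proof -
    have "\<mm>2 +> z \<in> N" using \<open>carrier ?V \<subseteq> N\<close> z by (auto simp: cotangent_space_simps)
    then obtain x where x: "x \<in> ?J" "\<mm>2 +> z = \<mm>2 +> x" by (auto simp: N_def)
    then have "z \<ominus> x \<in> \<mm>2"
      using quotient_eq_iff_same_a_r_cos[OF square_ideal, of z x] m.Icarr[OF z] J.Icarr[OF x(1)] by simp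
    then show ?thesis using x(1) by blast
  qed
  \<comment> \<open>An auxiliary finite generating set of unrelated size, whose elements the
    induction in Nakayama's lemma strips off.\<close>
  obtain C where C: "C \<subseteq> carrier R" "finite C" "\<mm> = Idl C"
    using finetely_gen[OF m.is_ideal] by auto
  obtain gs where gs: "set gs = C" using finite_list[OF C(2)] by blast
  have Cm: "C \<subseteq> \<mm>" unfolding C(3) using C(1) by (rule genideal_self)
  have "\<mm> = ?J"
  proof (rule nakayama_max_ideal[OF J.is_ideal Jm gen])
    show "set gs \<subseteq> \<mm>" using gs Cm by simp
    have "Idl C \<subseteq> Idl (?J \<union> C)"
      using J.a_subset C(1) by (intro subset_Idl_subset) auto
    then show "\<mm> \<subseteq> Idl (?J \<union> set gs)" using C(3) gs by simp
  qed
  then show ?thesis using xs BR by (intro exI[of _ xs]) simp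
qed

lemma edim_eq: "edim R = enat (vectorspace.dim (R Quot \<mm>) (cotangent_space R))"
  using cotangent_fin_dim by (simp add: edim_def Let_def)

end

theorem proposition3p6:
  fixes R :: "('r, 'x) ring_scheme"
  assumes "cring R" and "noetherian_ring R"
  shows "(\<forall>m n xs. maximalideal m R \<and> set xs \<subseteq> carrier R \<and> length xs = n \<and> m = genideal R (set xs) \<longrightarrow>
            (\<exists>P :: ('r, nat \<Rightarrow> 'r) cplx.
               quasi_projective_resolution R (quot_module (ring_as_module R) m) P \<and>
               complex_length P = ereal (real n)))
       \<and> (local_ring R \<longrightarrow>
            qpd TYPE(nat \<Rightarrow> 'r) R (residue_module R) \<le> ereal_of_enat (edim R) \<and> edim R < \<infinity>)
       \<and> (\<forall>(M :: ('r, 'm, 'y) module_scheme) r.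
            module R M \<and> \<not> zero_module M \<and>
            periodic_module TYPE('p) R M \<and> periodicity TYPE('p) R M = r \<longrightarrow>
            qpd TYPE('p) R M = 0)"
proof (intro conjI allI impI)
  fix m n xs
  assume *: "maximalideal m R \<and> set xs \<subseteq> carrier R \<and> length xs = n \<and> m = genideal R (set xs)"
  then have xs: "set xs \<subseteq> carrier R" and m: "maximalideal m R" "m = genideal R (set xs)" by auto
  note K = koszul_quasi_projective_resolution[OF assms xs m]
  have "complex_length (koszul R xs) = ereal (real n)"
    using * K(2,3) by (simp add: complex_length_def)
  then show "\<exists>P :: ('r, nat \<Rightarrow> 'r) cplx.
      quasi_projective_resolution R (quot_module (ring_as_module R) m) P \<and> complex_length P = ereal (real n)"
    using K(1) unfolding finite_quasi_projective_resolution_def by blast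
next
  assume "local_ring R"
  then interpret noetherian_local R
    using assms by (simp add: noetherian_local_def noetherian_local_axioms_def)
  obtain xs where xs: "set xs \<subseteq> carrier R" "max_ideal R = genideal R (set xs)"
      "length xs = vectorspace.dim (R Quot max_ideal R) (cotangent_space R)"
    using max_ideal_generators by blast
  note K = koszul_quasi_projective_resolution[OF assms xs(1) maximalideal_max_ideal xs(2)]
  have "qpd TYPE(nat \<Rightarrow> 'r) R (residue_module R) \<le> csup (koszul R xs) - hsup (koszul R xs)"
    unfolding qpd_def residue_module_def by (rule Inf_lower) (use K(1) in blast)
  \<comment> \<open>The exact value of \<open>hsup\<close> remains open; nonzero homology in degree
    0 is enough for the bound.\<close>
  also have "\<dots> \<le> csup (koszul R xs) - 0" using K(4) by (intro ereal_minus_mono) auto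
  also have "\<dots> = ereal_of_enat (edim R)" using K(2) by (simp add: edim_eq xs(3))
  finally show "qpd TYPE(nat \<Rightarrow> 'r) R (residue_module R) \<le> ereal_of_enat (edim R)" .
  show "edim R < \<infinity>" by (simp add: edim_eq)
next
  fix M :: "('r, 'm, 'y) module_scheme" and r
  assume "module R M \<and> \<not> zero_module M \<and> periodic_module TYPE('p) R M \<and> periodicity TYPE('p) R M = r"
  then show "qpd TYPE('p) R M = 0"
    using periodic_qpd_eq_0 unfolding periodic_module_def by blast
qed

end
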